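(* Consider the plant, the data matrices $U_1,\Psi_0,\Psi_1$, the unknown matrix $W_0$ and the auxiliary system defined in the context. Assume: all eigenvalues of $S$ belong to $\{z\in\mathbb{C}: |z|\ge 1\}$; the pair $(A,C)$ is observable with (known) observability index $\ell$; and there are a matrix $\hat L_0$ and a (known) matrix $\hat{\mathbf M}\in\mathbb{R}^{\hat n_w\times(T-\ell+1)}$ such that $W_0=\hat L_0\hat{\mathbf M}$. Let $N:=(m+p)\ell+pd$. Consider the semidefinite program in the decision variables $\mathcal X\in\mathbb{R}^{N\times N}$ symmetric and $\mathcal Y\in\mathbb{R}^{(T-\ell+1)\times N}$: $$\mathcal X\succ 0,\qquad \begin{bmatrix}\mathcal X\\ 0_{\hat n_w,N}\end{bmatrix}=\begin{bmatrix}\Psi_0\\ \hat{\mathbf M}\end{bmatrix}\mathcal Y,\qquad \begin{bmatrix}\mathcal X & \Psi_1\mathcal Y\\ (\Psi_1\mathcal Y)^\top & \mathcal X\end{bmatrix}\succ 0 .$$ If this program is feasible, with feasible $(\mathcal X,\mathcal Y)$, then the control law $$\mu^+=\Phi\mu+G\varphi,\qquad v=\mathcal K\begin{bmatrix}\xi\\ \mu\end{bmatrix},\qquad \mathcal K:=U_1\mathcal Y\mathcal X^{-1},$$ solves the output regulation problem for the auxiliary system, that is, the closed loop $$\omega^+=S\omega,\quad \xi^+=\mathbf A\xi+\mathbf B v+\mathbf L Z_2\mathbf S\omega,\quad \mu^+=\Phi\mu+G\varphi,\quad \varphi=Z_1\xi+Z_2\mathbf S\omega,\quad v=\mathcal K\begin{bmatrix}\xi\\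 \mu\end{bmatrix}$$ (i) is globally asymptotically stable with $\omega=0$ (i.e. the origin of the resulting $(\xi,\mu)$-dynamics is globally asymptotically stable), and (ii) satisfies $\lim_{k\to\infty}\varphi(k)=0$ for each initial condition $(\omega(0),\xi(0),\mu(0))$.
   Context: All vectors and matrices are real. $x^+$ denotes the value of $x$ at the next time step (discrete time); $M\succ0$ means symmetric positive definite; $I$ and $0$ are identity and zero matrices; $(x_1,\dots,x_k)$ denotes the stacked column vector. Plant: $w^+=Sw$, $x^+=Ax+Bu+Pw$, $y=Cx+Qw$ with $w\in\mathbb{R}^{n_w}$ (exosignal), $x\in\mathbb{R}^n$, $u\in\mathbb{R}^m$, $y\in\mathbb{R}^p$. $S$ is known; $A,B,P,C,Q$, $w$, $x$ are unknown to the designer. Observability index: if $(A,C)$ is observable, $\ell$ is the smallest integer $l\ge1$ such that the stacked matrix with block rows $C,CA,\dots,CA^{l-1}$ has rank $n$. Internal model: let $\lambda^d+s_{d-1}\lambda^{d-1}+\dots+s_1\lambda+s_0$ be the minimal polynomial of $S$. $\Phi\in\mathbb{R}^{pd\times pd}$ is the block companion matrix with $d\times d$ blocks of size $p\times p$: for $i=1,\dots,d-1$ its $i$-th block row has $I_p$ in block column $i+1$ and zeros elsewhere, and its last block row is $[-s_0I_p,\,-s_1I_p,\dots,-s_{d-1}I_p]$. $G\in\mathbb{R}^{pd\times p}$ has $I_p$ as last block and zeros elsewhere. The internal model is $\eta^+=\Phi\eta+Gy$. Data: for an integer $T\ge\ell$, a trajectory of the plant and of the internal model is collected (arbitrary initial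 $w(0),x(0),\eta(0)$ and input sequence $u(0),\dots,u(T)$). For $k=\ell,\dots,T+1$ let $\psi(k):=(y(k-\ell),\dots,y(k-1),u(k-\ell),\dots,u(k-1),\eta(k))\in\mathbb{R}^{(m+p)\ell+pd}$. Define $U_1:=[u(\ell)\ u(\ell+1)\ \cdots\ u(T)]$, $\Psi_0:=[\psi(\ell)\ \psi(\ell+1)\ \cdots\ \psi(T)]$, $\Psi_1:=[\psi(\ell+1)\ \psi(\ell+2)\ \cdots\ \psi(T+1)]$, $W_0:=[w(\ell)\ w(\ell+1)\ \cdots\ w(T)]$. The matrices $U_1,\Psi_0,\Psi_1$ are known; $W_0$ is not. Auxiliary matrices: $\mathcal O$ is the matrix with block rows $C,CA,\dots,CA^{\ell-1}$ and $\mathcal O^{\mathrm L}$ is a (fixed) left inverse, $\mathcal O^{\mathrm L}\mathcal O=I_n$. $\mathcal T_{\mathrm u}\in\mathbb{R}^{p\ell\times m\ell}$ is block lower triangular Toeplitz with $(i,j)$ block $CA^{i-j-1}B$ for $i>j$ and $0$ for $i\le j$; $\mathcal T_{\mathrm w}\in\mathbb{R}^{p\ell\times n_w\ell}$ has $(i,j)$ block $CA^{i-j-1}P$ for $i>j$, $Q$ for $i=j$, $0$ for $i<j$ ($1\le i,j\le\ell$). $\mathcal R_{\mathrm u}:=[A^{\ell-1}B\ \cdots\ AB\ B]$, $\mathcal R_{\mathrm w}:=[A^{\ell-1}P\ \cdots\ AP\ P]$. $Z_1:=[\,CA^\ell\mathcal O^{\mathrm L}\ \ \ C\mathcal R_{\mathrm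 u}-CA^\ell\mathcal O^{\mathrm L}\mathcal T_{\mathrm u}\,]$, $Z_2:=[\,C\mathcal R_{\mathrm w}-CA^\ell\mathcal O^{\mathrm L}\mathcal T_{\mathrm w}\ \ \ Q\,]$. $\mathbf S$ is the matrix with block rows $S^{-\ell},S^{-\ell+1},\dots,S^{-1},I_{n_w}$ ($S$ is invertible under the eigenvalue assumption). On $\mathbb{R}^{(p+m)\ell}$, with vectors partitioned as $(a_1,\dots,a_\ell,b_1,\dots,b_\ell)$, $a_i\in\mathbb{R}^p$, $b_i\in\mathbb{R}^m$: $\mathbf F$ is the matrix of $(a_1,\dots,a_\ell,b_1,\dots,b_\ell)\mapsto(a_2,\dots,a_\ell,0,b_2,\dots,b_\ell,0)$; $\mathbf L\in\mathbb{R}^{(p+m)\ell\times p}$ is the matrix of $a\mapsto(0,\dots,0,a,0,\dots,0)$ with $a$ in position $a_\ell$; $\mathbf B\in\mathbb{R}^{(p+m)\ell\times m}$ is the matrix of $b\mapsto(0,\dots,0,b)$ with $b$ in position $b_\ell$. $\mathbf A:=\mathbf F+\mathbf LZ_1$. Auxiliary system: $\omega^+=S\omega$, $\xi^+=\mathbf A\xi+\mathbf Bv+\mathbf LZ_2\mathbf S\omega$, $\varphi=Z_1\xi+Z_2\mathbf S\omega$, with $\omega\in\mathbb{R}^{n_w}$, $\xi\in\mathbb{R}^{(p+m)\ell}$, input $v\in\mathbb{R}^m$, output $\varphi\in\mathbb{R}^p$; $\mu\in\mathbb{R}^{pd}$ is the controller state. *)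

theory Defs
  imports
    "Jordan_Normal_Form.Char_Poly"
    "Jordan_Normal_Form.DL_Rank"
    "Jordan_Normal_Form.Gauss_Jordan_Elimination"
begin

text \<open>Indices of blocks and of matrix entries start at 0, so the block \<open>(i, j)\<close> of the usual
  1-based notation is the block \<open>(i - 1, j - 1)\<close> below. Dimensions are read off the matrix
  arguments: \<open>dim_row A\<close> is the state dimension, \<open>dim_col B\<close> the number of inputs,
  \<open>dim_row C\<close> the number of outputs, \<open>dim_row S\<close> the dimension of the exosignal.\<close>

definition block_mat ::
  "nat \<Rightarrow> nat \<Rightarrow> nat \<Rightarrow> nat \<Rightarrow> (nat \<Rightarrow> nat \<Rightarrow> real mat) \<Rightarrow> real mat" where
  "block_mat r c h w M =
     mat (r * h) (c * w) (\<lambda>(i, j). M (i div h) (j div w) $$ (i mod h, j mod w))"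

definition stack_vec :: "nat \<Rightarrow> nat \<Rightarrow> (nat \<Rightarrow> real vec) \<Rightarrow> real vec" where
  "stack_vec r h f = vec (r * h) (\<lambda>i. f (i div h) $ (i mod h))"

definition append_cols :: "real mat \<Rightarrow> real mat \<Rightarrow> real mat" where
  "append_cols M N = four_block_mat M N (0\<^sub>m 0 (dim_col M)) (0\<^sub>m 0 (dim_col N))"

text \<open>Meaningful for invertible matrices only.\<close>

definition inv_mat :: "real mat \<Rightarrow> real mat" where
  "inv_mat M = the (mat_inverse M)"

definition pos_def_mat :: "nat \<Rightarrow> real mat \<Rightarrow> bool" where
  "pos_def_mat k M \<longleftrightarrow> M \<in> carrier_mat k k \<and> transpose_mat M = M \<and>
     (\<forall>v \<in> carrier_vec k. v \<noteq> 0\<^sub>v k \<longrightarrow> 0 < v \<bullet> (M *\<^sub>v v))"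

definition eucl_norm :: "real vec \<Rightarrow> real" where
  "eucl_norm v = sqrt (v \<bullet> v)"

definition poly_mat :: "real poly \<Rightarrow> real mat \<Rightarrow> real mat" where
  "poly_mat q M = mat (dim_row M) (dim_row M)
     (\<lambda>(i, j). \<Sum>k\<le>degree q. coeff q k * (M ^\<^sub>m k) $$ (i, j))"

definition is_minimal_poly :: "real mat \<Rightarrow> real poly \<Rightarrow> bool" where
  "is_minimal_poly M q \<longleftrightarrow>
     lead_coeff q = 1 \<and> poly_mat q M = 0\<^sub>m (dim_row M) (dim_row M) \<and>
     (\<forall>r. r \<noteq> 0 \<and> poly_mat r M = 0\<^sub>m (dim_row M) (dim_row M) \<longrightarrow> degree q \<le> degree r)"

definition obs_mat :: "real mat \<Rightarrow> real mat \<Rightarrow> nat \<Rightarrow> real mat" where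
  "obs_mat A C l = block_mat l 1 (dim_row C) (dim_row A) (\<lambda>i _. C * A ^\<^sub>m i)"

definition obs_rank :: "real mat \<Rightarrow> real mat \<Rightarrow> nat \<Rightarrow> nat" where
  "obs_rank A C l = vec_space.rank (dim_row (obs_mat A C l)) (obs_mat A C l)"

definition observable :: "real mat \<Rightarrow> real mat \<Rightarrow> bool" where
  "observable A C \<longleftrightarrow> obs_rank A C (dim_row A) = dim_row A"

text \<open>Meaningful for observable pairs only.\<close>

definition obs_index :: "real mat \<Rightarrow> real mat \<Rightarrow> nat" where
  "obs_index A C = (LEAST l. 1 \<le> l \<and> obs_rank A C l = dim_row A)"

definition int_model_Phi :: "nat \<Rightarrow> real poly \<Rightarrow> real mat" where
  "int_model_Phi p q = block_mat (degree q) (degree q) p p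
     (\<lambda>i j. if Suc i < degree q
            then (if j = Suc i then 1\<^sub>m p else 0\<^sub>m p p)
            else (- coeff q j) \<cdot>\<^sub>m 1\<^sub>m p)"

definition int_model_G :: "nat \<Rightarrow> real poly \<Rightarrow> real mat" where
  "int_model_G p q = block_mat (degree q) 1 p p
     (\<lambda>i _. if Suc i = degree q then 1\<^sub>m p else 0\<^sub>m p p)"

text \<open>A trajectory of the plant and of the internal model for the times \<open>0, \<dots>, T\<close>
  (with the states also at time \<open>T + 1\<close>), with arbitrary input.\<close>

definition plant_trajectory ::
  "nat \<Rightarrow> real mat \<Rightarrow> real mat \<Rightarrow> real mat \<Rightarrow> real mat \<Rightarrow> real mat \<Rightarrow> real mat \<Rightarrow>
   (nat \<Rightarrow> real vec) \<Rightarrow> (nat \<Rightarrow> real vec) \<Rightarrow> (nat \<Rightarrow> real vec) \<Rightarrow> (nat \<Rightarrow> real vec) \<Rightarrow> bool" where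
  "plant_trajectory T S A B P C Q w x u y \<longleftrightarrow>
     w 0 \<in> carrier_vec (dim_row S) \<and> x 0 \<in> carrier_vec (dim_row A) \<and>
     (\<forall>k\<le>T. u k \<in> carrier_vec (dim_col B) \<and>
            w (Suc k) = S *\<^sub>v w k \<and>
            x (Suc k) = A *\<^sub>v x k + B *\<^sub>v u k + P *\<^sub>v w k \<and>
            y k = C *\<^sub>v x k + Q *\<^sub>v w k)"

definition int_model_trajectory ::
  "nat \<Rightarrow> real mat \<Rightarrow> real mat \<Rightarrow> (nat \<Rightarrow> real vec) \<Rightarrow> (nat \<Rightarrow> real vec) \<Rightarrow> bool" where
  "int_model_trajectory T \<Phi> G y \<eta> \<longleftrightarrow>
     \<eta> 0 \<in> carrier_vec (dim_row \<Phi>) \<and>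
     (\<forall>k\<le>T. \<eta> (Suc k) = \<Phi> *\<^sub>v \<eta> k + G *\<^sub>v y k)"

text \<open>The vector \<open>(y(k - l), \<dots>, y(k - 1), u(k - l), \<dots>, u(k - 1), \<eta>(k))\<close>; used for \<open>l \<le> k\<close> only.\<close>

definition data_vec ::
  "nat \<Rightarrow> nat \<Rightarrow> nat \<Rightarrow> (nat \<Rightarrow> real vec) \<Rightarrow> (nat \<Rightarrow> real vec) \<Rightarrow> (nat \<Rightarrow> real vec) \<Rightarrow>
   nat \<Rightarrow> real vec" where
  "data_vec p m l y u \<eta> k =
     stack_vec l p (\<lambda>i. y (k - l + i)) @\<^sub>v stack_vec l m (\<lambda>i. u (k - l + i)) @\<^sub>v \<eta> k"

definition data_mat :: "nat \<Rightarrow> (nat \<Rightarrow> real vec) \<Rightarrow> nat \<Rightarrow> nat \<Rightarrow> real mat" where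
  "data_mat h f a b = mat_of_cols h (map f [a..<Suc b])"

definition toep_u :: "real mat \<Rightarrow> real mat \<Rightarrow> real mat \<Rightarrow> nat \<Rightarrow> real mat" where
  "toep_u A B C l = block_mat l l (dim_row C) (dim_col B)
     (\<lambda>i j. if j < i then C * A ^\<^sub>m (i - j - 1) * B else 0\<^sub>m (dim_row C) (dim_col B))"

definition toep_w :: "real mat \<Rightarrow> real mat \<Rightarrow> real mat \<Rightarrow> real mat \<Rightarrow> nat \<Rightarrow> real mat" where
  "toep_w A P C Q l = block_mat l l (dim_row C) (dim_col P)
     (\<lambda>i j. if j < i then C * A ^\<^sub>m (i - j - 1) * P
            else if i = j then Q else 0\<^sub>m (dim_row C) (dim_col P))"

definition reach_mat :: "real mat \<Rightarrow> real mat \<Rightarrow> nat \<Rightarrow> real mat" where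
  "reach_mat A B l = block_mat 1 l (dim_row A) (dim_col B) (\<lambda>_ j. A ^\<^sub>m (l - 1 - j) * B)"

definition aux_Z1 ::
  "real mat \<Rightarrow> real mat \<Rightarrow> real mat \<Rightarrow> real mat \<Rightarrow> nat \<Rightarrow> real mat" where
  "aux_Z1 A B C OL l = append_cols (C * A ^\<^sub>m l * OL)
     (C * reach_mat A B l - C * A ^\<^sub>m l * OL * toep_u A B C l)"

definition aux_Z2 ::
  "real mat \<Rightarrow> real mat \<Rightarrow> real mat \<Rightarrow> real mat \<Rightarrow> real mat \<Rightarrow> nat \<Rightarrow> real mat" where
  "aux_Z2 A P C Q OL l = append_cols
     (C * reach_mat A P l - C * A ^\<^sub>m l * OL * toep_w A P C Q l) Q"

definition exo_stack :: "real mat \<Rightarrow> nat \<Rightarrow> real mat" where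
  "exo_stack S l = block_mat (Suc l) 1 (dim_row S) (dim_row S) (\<lambda>i _. inv_mat S ^\<^sub>m (l - i))"

definition shift_mat :: "nat \<Rightarrow> nat \<Rightarrow> real mat" where
  "shift_mat l h = block_mat l l h h (\<lambda>i j. if j = Suc i then 1\<^sub>m h else 0\<^sub>m h h)"

definition last_block :: "nat \<Rightarrow> nat \<Rightarrow> real mat" where
  "last_block l h = block_mat l 1 h h (\<lambda>i _. if Suc i = l then 1\<^sub>m h else 0\<^sub>m h h)"

definition aux_F :: "nat \<Rightarrow> nat \<Rightarrow> nat \<Rightarrow> real mat" where
  "aux_F p m l = four_block_mat (shift_mat l p) (0\<^sub>m (l * p) (l * m))
                                (0\<^sub>m (l * m) (l * p)) (shift_mat l m)"

definition aux_L :: "nat \<Rightarrow> nat \<Rightarrow> nat \<Rightarrow> real mat" where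
  "aux_L p m l = last_block l p @\<^sub>r 0\<^sub>m (l * m) p"

definition aux_B :: "nat \<Rightarrow> nat \<Rightarrow> nat \<Rightarrow> real mat" where
  "aux_B p m l = 0\<^sub>m (l * p) m @\<^sub>r last_block l m"

definition sdp_feasible ::
  "nat \<Rightarrow> nat \<Rightarrow> nat \<Rightarrow> real mat \<Rightarrow> real mat \<Rightarrow> real mat \<Rightarrow> real mat \<Rightarrow> real mat \<Rightarrow> bool" where
  "sdp_feasible N c nh \<Psi>0 \<Psi>1 M X Y \<longleftrightarrow>
     Y \<in> carrier_mat c N \<and>
     pos_def_mat N X \<and>
     X @\<^sub>r 0\<^sub>m nh N = (\<Psi>0 @\<^sub>r M) * Y \<and>
     pos_def_mat (2 * N) (four_block_mat X (\<Psi>1 * Y) (transpose_mat (\<Psi>1 * Y)) X)"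

definition aux_output ::
  "real mat \<Rightarrow> real mat \<Rightarrow> real mat \<Rightarrow> real vec \<times> real vec \<times> real vec \<Rightarrow> real vec" where
  "aux_output Z1 Z2 SS = (\<lambda>(\<omega>, \<xi>, \<mu>). Z1 *\<^sub>v \<xi> + (Z2 * SS) *\<^sub>v \<omega>)"

definition closed_loop_step ::
  "real mat \<Rightarrow> real mat \<Rightarrow> real mat \<Rightarrow> real mat \<Rightarrow> real mat \<Rightarrow> real mat \<Rightarrow> real mat \<Rightarrow>
   real mat \<Rightarrow> real mat \<Rightarrow> real mat \<Rightarrow>
   real vec \<times> real vec \<times> real vec \<Rightarrow> real vec \<times> real vec \<times> real vec" where
  "closed_loop_step S AA BB LL Z1 Z2 SS \<Phi> G K = (\<lambda>(\<omega>, \<xi>, \<mu>).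
     let \<phi> = aux_output Z1 Z2 SS (\<omega>, \<xi>, \<mu>);
         v = K *\<^sub>v (\<xi> @\<^sub>v \<mu>)
     in (S *\<^sub>v \<omega>,
         AA *\<^sub>v \<xi> + BB *\<^sub>v v + (LL * Z2 * SS) *\<^sub>v \<omega>,
         \<Phi> *\<^sub>v \<mu> + G *\<^sub>v \<phi>))"

text \<open>The dynamics of the stacked state \<open>(\<xi>, \<mu>)\<close> obtained from a step function on \<open>(\<omega>, \<xi>, \<mu>)\<close>
  by setting \<open>\<omega> = 0\<close>.\<close>

definition zero_exo_dynamics ::
  "nat \<Rightarrow> nat \<Rightarrow> nat \<Rightarrow>
   (real vec \<times> real vec \<times> real vec \<Rightarrow> real vec \<times> real vec \<times> real vec) \<Rightarrow>
   real vec \<Rightarrow> real vec" where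
  "zero_exo_dynamics nw a b step z =
     (case step (0\<^sub>v nw, vec_first z a, vec_last z b) of (_, \<xi>, \<mu>) \<Rightarrow> \<xi> @\<^sub>v \<mu>)"

text \<open>Global asymptotic stability of the origin for \<open>z\<^sup>+ = f z\<close>: the origin is an equilibrium,
  it is Lyapunov stable, and every solution converges to it.\<close>

definition origin_GAS :: "nat \<Rightarrow> (real vec \<Rightarrow> real vec) \<Rightarrow> bool" where
  "origin_GAS N f \<longleftrightarrow>
     f (0\<^sub>v N) = 0\<^sub>v N \<and>
     (\<forall>\<epsilon>>0. \<exists>\<delta>>0. \<forall>z \<in> carrier_vec N. eucl_norm z < \<delta> \<longrightarrow> (\<forall>k. eucl_norm ((f ^^ k) z) < \<epsilon>)) \<and>
     (\<forall>z \<in> carrier_vec N. (\<lambda>k. eucl_norm ((f ^^ k) z)) \<longlonglongrightarrow> 0)"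

end

theory Submission
  imports Defs "Jordan_Normal_Form.Spectral_Radius"
begin

text \<open>
  Write \<open>\<chi>(k)\<close> for the vector of the last \<open>l\<close> outputs and inputs. The left inverse of the observability
  matrix recovers \<open>x(k - l)\<close>, and with the past inputs also \<open>x(k)\<close>, from \<open>\<chi>(k)\<close> and past values of the
  exosignal, which are functions of \<open>w(k)\<close> because \<open>S\<close> is invertible (0 is not an eigenvalue). Hence \<open>y = Z1 \<chi> + Z2 SS w\<close> along the data
  (\<open>output_from_past\<close>, \<open>exo_stack_mult\<close>): the measured \<open>\<psi>\<close> is a trajectory of the auxiliary system in
  series with the internal model, \<open>\<psi>\<^sup>+ = A0 \<psi> + B0 u + D w\<close> (\<open>data_vec_step\<close>), where \<open>A0\<close>, \<open>B0\<close> and \<open>D\<close>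
  are the unknown matrices of that series connection. In matrix form this is
  \<open>\<Psi>1 = A0 \<Psi>0 + B0 U1 + D W0\<close>. The constraint \<open>Mhat Y = 0\<close> removes the unknown \<open>W0 = Lhat Mhat\<close>, and with
  \<open>\<Psi>0 Y = X\<close> there remains \<open>\<Psi>1 Y = (A0 + B0 K) X\<close>; the matrix inequality of the program is therefore the
  discrete Lyapunov inequality of the closed-loop matrix \<open>A0 + B0 K\<close> (\<open>sdp_feasible_closed_loop\<close>).

  The inequality is evaluated on left eigenvectors, which places all eigenvalues of \<open>A0 + B0 K\<close> in the open
  unit disc (\<open>lmi_eigenvalue_norm_less_1\<close>). Powers of a matrix of spectral radius below 1 are bounded;
  applied to a slightly scaled matrix, this gives geometric decay and so global asymptotic stability
  (\<open>origin_GAS_linear\<close>).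

  For the regulated output no steady-state (Sylvester) equation is solved. Let \<open>q\<close> be the minimal
  polynomial of \<open>S\<close> and apply the filter \<open>z \<mapsto> (\<Sum>j\<le>d. q\<^sub>j z(k + j))\<close> to a closed-loop trajectory.
  Since \<open>q\<close> annihilates \<open>S\<close>, the filter removes the exosignal, so the filtered state obeys the stable
  homogeneous recursion and tends to 0 (\<open>filtered_state_tendsto_0\<close>). By the companion form of \<open>\<Phi>\<close>, the same
  filter applied to the first block of \<open>\<mu>\<close> returns the input \<open>\<phi>\<close> of the internal model
  (\<open>int_model_reconstructs_input\<close>). So \<open>\<phi>\<close> is a block of the filtered state and tends to 0.
\<close>

section \<open>Stability certified by the linear matrix inequality\<close>

lemma pos_def_matD:
  assumes "pos_def_mat k M"
  shows "M \<in> carrier_mat k k" "transpose_mat M = M"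
    "v \<in> carrier_vec k \<Longrightarrow> v \<noteq> 0\<^sub>v k \<Longrightarrow> 0 < v \<bullet> (M *\<^sub>v v)"
  using assms by (auto simp: pos_def_mat_def)

text \<open>Evaluating the block matrix at \<open>(s, -A\<^sup>T s)\<close>, the choice of the Schur complement, yields
  \<open>X - A X A\<^sup>T \<succ> 0\<close>. The quadratic form of \<open>X\<close> is thus a Lyapunov function of the transposed system;
  working with the transpose avoids the inverse of \<open>X\<close>.\<close>

lemma lmi_lyapunov_decrease:
  assumes X: "pos_def_mat N X" and A: "A \<in> carrier_mat N N"
    and lmi: "pos_def_mat (2 * N) (four_block_mat X (A * X) (transpose_mat (A * X)) X)"
    and s: "s \<in> carrier_vec N" "s \<noteq> 0\<^sub>v N"
  defines "t \<equiv> transpose_mat A *\<^sub>v s"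
  shows "t \<bullet> (X *\<^sub>v t) < s \<bullet> (X *\<^sub>v s)"
proof -
  note XD = pos_def_matD[OF X]
  have At: "transpose_mat A \<in> carrier_mat N N" using A by simp
  have t: "t \<in> carrier_vec N" unfolding t_def using At s by auto
  have AX: "A * X \<in> carrier_mat N N" using A XD by auto
  let ?v = "s @\<^sub>v (- t)"
  have v: "?v \<in> carrier_vec (2 * N)" using s t by (simp add: mult_2)
  have "?v \<noteq> 0\<^sub>v (2 * N)"
  proof
    assume eq: "?v = 0\<^sub>v (2 * N)"
    have "s $ i = 0" if "i < N" for i
      using arg_cong[OF eq, of "\<lambda>v. v $ i"] that s t by auto
    with s show False by (auto intro!: eq_vecI)
  qed
  from pos_def_matD(3)[OF lmi v this]
  have pos: "0 < ?v \<bullet> (four_block_mat X (A * X) (transpose_mat (A * X)) X *\<^sub>v ?v)" .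
  have mult: "four_block_mat X (A * X) (transpose_mat (A * X)) X *\<^sub>v ?v
      = (X *\<^sub>v s + (A * X) *\<^sub>v (- t)) @\<^sub>v (transpose_mat (A * X) *\<^sub>v s + X *\<^sub>v (- t))"
    by (rule four_block_mat_mult_vec[of _ N N _ N _ N]) (use XD AX s t in auto)
  \<comment> \<open>Both mixed terms equal the last quadratic term, which leaves one copy with a negative sign.\<close>
  have c1: "s \<bullet> ((A * X) *\<^sub>v t) = t \<bullet> (X *\<^sub>v t)"
  proof -
    have "(A * X) *\<^sub>v t = A *\<^sub>v (X *\<^sub>v t)" using A XD t by auto
    then show ?thesis unfolding t_def
      by (metis A At XD(1) mult_mat_vec_carrier s(1) transpose_vec_mult_scalar)
  qed
  have c2: "t \<bullet> (transpose_mat (A * X) *\<^sub>v s) = s \<bullet> ((A * X) *\<^sub>v t)"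
    using transpose_vec_mult_scalar[OF AX t s(1)] AX t s
    by (metis comm_scalar_prod mult_mat_vec_carrier transpose_carrier_mat)
  have n1: "(A * X) *\<^sub>v (- t) = - ((A * X) *\<^sub>v t)" "X *\<^sub>v (- t) = - (X *\<^sub>v t)"
    using AX XD t by (auto simp: uminus_mult_mat_vec intro!: eq_vecI)
  have "?v \<bullet> (four_block_mat X (A * X) (transpose_mat (A * X)) X *\<^sub>v ?v)
      = s \<bullet> (X *\<^sub>v s + - ((A * X) *\<^sub>v t)) + (- t) \<bullet> (transpose_mat (A * X) *\<^sub>v s + - (X *\<^sub>v t))"
    unfolding mult n1 by (rule scalar_prod_append) (use s t XD AX in auto)
  also have "\<dots> = s \<bullet> (X *\<^sub>v s) + s \<bullet> (- ((A * X) *\<^sub>v t))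
      + ((- t) \<bullet> (transpose_mat (A * X) *\<^sub>v s) + (- t) \<bullet> (- (X *\<^sub>v t)))"
    using s t XD AX by (simp add: scalar_prod_add_distrib[of _ N] del: scalar_prod_uminus_left)
  also have "\<dots> = s \<bullet> (X *\<^sub>v s) - s \<bullet> ((A * X) *\<^sub>v t)
      - (t \<bullet> (transpose_mat (A * X) *\<^sub>v s) - t \<bullet> (X *\<^sub>v t))"
    using s t XD A by simp
  finally show ?thesis using pos c1 c2 by simp
qed

lemma quadratic_form_lincomb:
  fixes M :: "real mat"
  assumes M: "M \<in> carrier_mat N N" and a: "a \<in> carrier_vec N" and b: "b \<in> carrier_vec N"
  shows "(x \<cdot>\<^sub>v a + y \<cdot>\<^sub>v b) \<bullet> (M *\<^sub>v (x \<cdot>\<^sub>v a + y \<cdot>\<^sub>v b)) =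
    x\<^sup>2 * (a \<bullet> (M *\<^sub>v a)) + x * y * (a \<bullet> (M *\<^sub>v b) + b \<bullet> (M *\<^sub>v a)) + y\<^sup>2 * (b \<bullet> (M *\<^sub>v b))"
proof -
  have "M *\<^sub>v (x \<cdot>\<^sub>v a + y \<cdot>\<^sub>v b) = x \<cdot>\<^sub>v (M *\<^sub>v a) + y \<cdot>\<^sub>v (M *\<^sub>v b)"
    using M a b by (simp add: mult_add_distrib_mat_vec[of _ N N] mult_mat_vec)
  then show ?thesis using M a b
    by (simp add: scalar_prod_add_distrib[of _ N] add_scalar_prod_distrib[of _ N]
        power2_eq_square algebra_simps)
qed

text \<open>If \<open>a + i b\<close> is an eigenvector of \<open>A\<^sup>T\<close> for \<open>e\<close>, then \<open>A\<^sup>T\<close> acts on the pair \<open>(a, b)\<close> as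
  multiplication by \<open>e\<close>, and \<open>V(a) + V(b)\<close> for the quadratic form \<open>V\<close> of \<open>X\<close> is multiplied by exactly
  \<open>\<bar>e\<bar>\<^sup>2\<close>. The strict decrease of \<open>V\<close> forces \<open>\<bar>e\<bar> < 1\<close>.\<close>

lemma lmi_eigenvalue_norm_less_1:
  assumes X: "pos_def_mat N X" and A: "A \<in> carrier_mat N N"
    and lmi: "pos_def_mat (2 * N) (four_block_mat X (A * X) (transpose_mat (A * X)) X)"
    and ev: "eigenvalue (map_mat complex_of_real A) e"
  shows "cmod e < 1"
proof -
  note XD = pos_def_matD[OF X]
  let ?At = "transpose_mat A"
  have At: "?At \<in> carrier_mat N N" using A by simp
  have "eigenvalue (transpose_mat (map_mat complex_of_real A)) e"
    using ev A eigenvalue_root_char_poly[of "map_mat complex_of_real A" N e]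
      eigenvalue_root_char_poly[of "transpose_mat (map_mat complex_of_real A)" N e]
      char_poly_transpose_mat[of "map_mat complex_of_real A" N] by auto
  moreover have "transpose_mat (map_mat complex_of_real A) = map_mat complex_of_real ?At"
    by (auto intro!: eq_matI)
  ultimately obtain v where v: "v \<in> carrier_vec N" "v \<noteq> 0\<^sub>v N"
    and eq: "map_mat complex_of_real ?At *\<^sub>v v = e \<cdot>\<^sub>v v"
    using A unfolding eigenvalue_def eigenvector_def by auto
  define a where "a = map_vec Re v"
  define b where "b = map_vec Im v"
  have ab: "a \<in> carrier_vec N" "b \<in> carrier_vec N" using v by (auto simp: a_def b_def)
  have entry: "(\<Sum>j<N. complex_of_real (?At $$ (i, j)) * v $ j) = e * v $ i" if "i < N" for i
    using arg_cong[OF eq, of "\<lambda>u. u $ i"] that v A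
    by (simp add: scalar_prod_def lessThan_atLeast0)
  have Ata: "?At *\<^sub>v a = Re e \<cdot>\<^sub>v a + (- Im e) \<cdot>\<^sub>v b"
  proof (rule eq_vecI)
    fix i assume "i < dim_vec (Re e \<cdot>\<^sub>v a + (- Im e) \<cdot>\<^sub>v b)"
    then have i: "i < N" using ab by simp
    have "(?At *\<^sub>v a) $ i = Re (\<Sum>j<N. complex_of_real (?At $$ (i, j)) * v $ j)"
      using i v A by (simp add: scalar_prod_def lessThan_atLeast0 a_def)
    then show "(?At *\<^sub>v a) $ i = (Re e \<cdot>\<^sub>v a + (- Im e) \<cdot>\<^sub>v b) $ i"
      unfolding entry[OF i] using i v by (simp add: a_def b_def)
  qed (use ab A in auto)
  have Atb: "?At *\<^sub>v b = Im e \<cdot>\<^sub>v a + Re e \<cdot>\<^sub>v b"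
  proof (rule eq_vecI)
    fix i assume "i < dim_vec (Im e \<cdot>\<^sub>v a + Re e \<cdot>\<^sub>v b)"
    then have i: "i < N" using ab by simp
    have "(?At *\<^sub>v b) $ i = Im (\<Sum>j<N. complex_of_real (?At $$ (i, j)) * v $ j)"
      using i v A by (simp add: scalar_prod_def lessThan_atLeast0 b_def)
    then show "(?At *\<^sub>v b) $ i = (Im e \<cdot>\<^sub>v a + Re e \<cdot>\<^sub>v b) $ i"
      unfolding entry[OF i] using i v by (simp add: a_def b_def)
  qed (use ab A in auto)
  define V where "V s = s \<bullet> (X *\<^sub>v s)" for s
  have V0: "V (0\<^sub>v N) = 0" unfolding V_def using XD by simp
  have le: "V (?At *\<^sub>v s) \<le> V s" "0 \<le> V s" if "s \<in> carrier_vec N" for s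
  proof -
    have "?At *\<^sub>v 0\<^sub>v N = 0\<^sub>v N" using At by auto
    then show "V (?At *\<^sub>v s) \<le> V s"
      using lmi_lyapunov_decrease[OF X A lmi that] unfolding V_def by fastforce
    show "0 \<le> V s" using XD(3)[OF that] V0 unfolding V_def by fastforce
  qed
  have "a \<noteq> 0\<^sub>v N \<or> b \<noteq> 0\<^sub>v N"
  proof (rule ccontr)
    assume "\<not> ?thesis"
    then have "Re (v $ i) = 0" "Im (v $ i) = 0" if "i < N" for i
      using that v unfolding a_def b_def
      by (metis carrier_vecD index_map_vec(1) index_zero_vec(1))+
    then have "v = 0\<^sub>v N" using v by (intro eq_vecI) (auto simp: complex_eq_iff)
    with v show False by simp
  qed
  then have less: "V (?At *\<^sub>v a) + V (?At *\<^sub>v b) < V a + V b"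
    using lmi_lyapunov_decrease[OF X A lmi ab(1)] lmi_lyapunov_decrease[OF X A lmi ab(2)]
      le(1)[OF ab(1)] le(1)[OF ab(2)] unfolding V_def by (auto intro: add_less_le_mono add_le_less_mono)
  have "V (?At *\<^sub>v a) + V (?At *\<^sub>v b) = (cmod e)\<^sup>2 * (V a + V b)"
    unfolding V_def Ata Atb quadratic_form_lincomb[OF XD(1) ab] cmod_power2
    by (simp add: algebra_simps power2_eq_square)
  with less have "(cmod e)\<^sup>2 * (V a + V b) < 1 * (V a + V b)" by simp
  then have "(cmod e)\<^sup>2 < 1\<^sup>2" using le(2)[OF ab(1)] le(2)[OF ab(2)]
    unfolding mult_less_cancel_right by simp
  then show ?thesis by (rule power_less_imp_less_base) simp
qed

lemma smult_mat_pow: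
  fixes A :: "'a :: comm_semiring_1 mat"
  assumes A: "A \<in> carrier_mat n n"
  shows "(c \<cdot>\<^sub>m A) ^\<^sub>m k = c ^ k \<cdot>\<^sub>m A ^\<^sub>m k"
proof (induction k)
  case 0
  then show ?case using A by (auto intro!: eq_matI)
next
  case (Suc k)
  have p: "A ^\<^sub>m k \<in> carrier_mat n n" using A by simp
  show ?case unfolding pow_mat.simps Suc
    by (rule eq_matI) (use A p in \<open>auto simp: scalar_prod_def sum_distrib_left ac_simps intro!: sum.cong\<close>)
qed

text \<open>With a radius \<open>r\<close> strictly between the spectral radius and 1, the matrix \<open>A / r\<close> still has spectral
  radius below 1, so its powers are bounded; this is the stated bound for the powers of \<open>A\<close>.\<close>

lemma mat_power_geometric_bound:
  fixes A :: "real mat"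
  assumes A: "A \<in> carrier_mat N N"
    and ev: "\<And>e. eigenvalue (map_mat complex_of_real A) e \<Longrightarrow> cmod e < 1"
  obtains c r where "0 \<le> c" "0 < r" "r < 1"
    "\<And>k i j. i < N \<Longrightarrow> j < N \<Longrightarrow> \<bar>(A ^\<^sub>m k) $$ (i, j)\<bar> \<le> c * r ^ k"
proof (cases "N = 0")
  case True
  show ?thesis by (rule that[of 0 "1/2"]) (use True in auto)
next
  case False
  let ?A = "map_mat complex_of_real A"
  have cA: "?A \<in> carrier_mat N N" using A by simp
  define \<rho> where "\<rho> = spectral_radius ?A"
  have \<rho>: "0 \<le> \<rho>" "\<rho> < 1"
    using spectral_radius_mem_max(1)[OF cA] False ev unfolding \<rho>_def spectrum_def by auto
  have \<rho>max: "cmod e \<le> \<rho>" if "eigenvalue ?A e" for e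
    using spectral_radius_mem_max(2)[OF cA] False that unfolding \<rho>_def spectrum_def by auto
  define r where "r = (1 + \<rho>) / 2"
  have r: "0 < r" "r < 1" "\<rho> < r" using \<rho> by (auto simp: r_def)
  let ?B = "complex_of_real (1 / r) \<cdot>\<^sub>m ?A"
  have cB: "?B \<in> carrier_mat N N" using cA by simp
  have evB: "cmod e < 1" if e: "eigenvalue ?B e" for e
  proof -
    obtain v where v: "v \<in> carrier_vec N" "v \<noteq> 0\<^sub>v N" and eq: "?B *\<^sub>v v = e \<cdot>\<^sub>v v"
      using e A unfolding eigenvalue_def eigenvector_def by auto
    have "?A *\<^sub>v v = (complex_of_real r * e) \<cdot>\<^sub>v v"
    proof (rule eq_vecI)
      fix i assume "i < dim_vec ((complex_of_real r * e) \<cdot>\<^sub>v v)"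
      then have i: "i < N" using v by simp
      have "(?A *\<^sub>v v) $ i = complex_of_real r * (?B *\<^sub>v v) $ i"
        using i A v r by (simp add: scalar_prod_def sum_distrib_left)
      then show "(?A *\<^sub>v v) $ i = ((complex_of_real r * e) \<cdot>\<^sub>v v) $ i"
        unfolding eq using i v by simp
    qed (use v A in auto)
    then have "eigenvalue ?A (complex_of_real r * e)"
      unfolding eigenvalue_def eigenvector_def using v A by auto
    from \<rho>max[OF this] r have "r * cmod e \<le> \<rho>" by (simp add: norm_mult)
    then have "r * cmod e < r * 1" using r by linarith
    then show ?thesis using r by (blast intro: mult_left_less_imp_less less_imp_le)
  qed
  have "spectral_radius ?B < 1"
    using spectral_radius_mem_max(1)[OF cB] False evB unfolding spectrum_def by auto
  from spectral_radius_jnf_norm_bound_less_1_upper_triangular[OF cB this]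
  obtain c where c: "\<And>k. norm_bound (?B ^\<^sub>m k) c" by auto
  have bound: "\<bar>(A ^\<^sub>m k) $$ (i, j)\<bar> \<le> c * r ^ k" if ij: "i < N" "j < N" for k i j
  proof -
    have "?B ^\<^sub>m k = complex_of_real (1 / r) ^ k \<cdot>\<^sub>m map_mat complex_of_real (A ^\<^sub>m k)"
      unfolding smult_mat_pow[OF cA] of_real_hom.mat_hom_pow[OF A] ..
    then have "norm (complex_of_real (1 / r) ^ k * complex_of_real ((A ^\<^sub>m k) $$ (i, j))) \<le> c"
      using c[of k] ij A unfolding norm_bound_def by auto
    then have "\<bar>(A ^\<^sub>m k) $$ (i, j)\<bar> / r ^ k \<le> c"
      using r by (simp add: norm_mult norm_power norm_divide power_divide divide_simps)
    then show ?thesis using r by (simp add: field_simps)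
  qed
  have "0 \<le> c" using bound[of 0 0 0] False by (simp add: order_trans[OF abs_ge_zero])
  with that[OF _ r(1,2) bound] show ?thesis by blast
qed

lemma abs_index_le_eucl_norm: "i < dim_vec v \<Longrightarrow> \<bar>v $ i\<bar> \<le> eucl_norm v"
  unfolding eucl_norm_def scalar_prod_def
  by (intro real_le_rsqrt) (auto simp: power2_eq_square intro: member_le_sum)

text \<open>The factor is the dimension instead of its square root, which is enough for every limit below.\<close>

lemma eucl_norm_le:
  assumes "\<And>i. i < dim_vec v \<Longrightarrow> \<bar>v $ i\<bar> \<le> b" "0 \<le> b"
  shows "eucl_norm v \<le> real (dim_vec v) * b"
proof -
  have "v \<bullet> v = (\<Sum>i<dim_vec v. \<bar>v $ i\<bar>\<^sup>2)"
    by (simp add: scalar_prod_def lessThan_atLeast0 power2_eq_square)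
  also have "\<dots> \<le> (\<Sum>i<dim_vec v. b\<^sup>2)"
    using assms(1) by (intro sum_mono power_mono) auto
  also have "\<dots> = real (dim_vec v) * b\<^sup>2" by simp
  also have "real (dim_vec v) \<le> (real (dim_vec v))\<^sup>2"
    by (cases "dim_vec v") (simp_all add: power2_eq_square)
  then have "real (dim_vec v) * b\<^sup>2 \<le> (real (dim_vec v))\<^sup>2 * b\<^sup>2" by (rule mult_right_mono) simp
  finally show ?thesis
    unfolding eucl_norm_def using assms(2) by (intro real_le_lsqrt) (auto simp: power_mult_distrib)
qed

lemma eucl_norm_nonneg: "0 \<le> eucl_norm v"
  unfolding eucl_norm_def by (simp add: scalar_prod_def sum_nonneg)

lemma eucl_norm_tendsto_0_iff:
  assumes dim: "\<And>k. dim_vec (v k) = n"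
  shows "(\<lambda>k. eucl_norm (v k)) \<longlonglongrightarrow> 0 \<longleftrightarrow> (\<forall>i<n. (\<lambda>k. v k $ i) \<longlonglongrightarrow> 0)"
proof
  assume lim: "(\<lambda>k. eucl_norm (v k)) \<longlonglongrightarrow> 0"
  show "\<forall>i<n. (\<lambda>k. v k $ i) \<longlonglongrightarrow> 0"
  proof (intro allI impI)
    fix i assume "i < n"
    then have "\<bar>v k $ i\<bar> \<le> eucl_norm (v k)" for k
      using abs_index_le_eucl_norm[of i "v k"] dim by simp
    then have "(\<lambda>k. \<bar>v k $ i\<bar>) \<longlonglongrightarrow> 0"
      by (intro tendsto_sandwich[OF _ _ tendsto_const lim]) auto
    then show "(\<lambda>k. v k $ i) \<longlonglongrightarrow> 0" by (rule tendsto_rabs_zero_cancel)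
  qed
next
  assume lim: "\<forall>i<n. (\<lambda>k. v k $ i) \<longlonglongrightarrow> 0"
  have "(\<lambda>k. sqrt (\<Sum>i<n. v k $ i * v k $ i)) \<longlonglongrightarrow> sqrt (\<Sum>i<n. 0 * 0)"
    using lim by (intro tendsto_intros) auto
  then show "(\<lambda>k. eucl_norm (v k)) \<longlonglongrightarrow> 0"
    by (simp add: eucl_norm_def scalar_prod_def dim lessThan_atLeast0)
qed

lemma mat_power_vec_geometric_bound:
  fixes A :: "real mat"
  assumes A: "A \<in> carrier_mat N N"
    and ev: "\<And>e. eigenvalue (map_mat complex_of_real A) e \<Longrightarrow> cmod e < 1"
  obtains c r where "0 \<le> c" "0 < r" "r < 1"
    "\<And>k z. z \<in> carrier_vec N \<Longrightarrow> eucl_norm (A ^\<^sub>m k *\<^sub>v z) \<le> c * r ^ k * eucl_norm z"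
proof -
  obtain c r where c: "0 \<le> c" and r: "0 < r" "r < 1"
    and bound: "\<And>k i j. i < N \<Longrightarrow> j < N \<Longrightarrow> \<bar>(A ^\<^sub>m k) $$ (i, j)\<bar> \<le> c * r ^ k"
    by (rule mat_power_geometric_bound[OF A ev]) auto
  have "eucl_norm (A ^\<^sub>m k *\<^sub>v z) \<le> (real N * real N * c) * r ^ k * eucl_norm z"
    if z: "z \<in> carrier_vec N" for k z
  proof -
    have Ak: "A ^\<^sub>m k \<in> carrier_mat N N" using A by simp
    have entry: "\<bar>(A ^\<^sub>m k *\<^sub>v z) $ i\<bar> \<le> real N * (c * r ^ k * eucl_norm z)" if i: "i < N" for i
    proof -
      have "\<bar>(A ^\<^sub>m k *\<^sub>v z) $ i\<bar> = \<bar>\<Sum>j<N. (A ^\<^sub>m k) $$ (i, j) * z $ j\<bar>"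
        using i z A by (simp add: scalar_prod_def lessThan_atLeast0)
      also have "\<dots> \<le> (\<Sum>j<N. \<bar>(A ^\<^sub>m k) $$ (i, j) * z $ j\<bar>)" by (rule sum_abs)
      also have "\<dots> \<le> (\<Sum>j<N. c * r ^ k * eucl_norm z)"
        unfolding abs_mult using bound[OF i] abs_index_le_eucl_norm[of _ z] z c r
        by (intro sum_mono mult_mono) auto
      finally show ?thesis by simp
    qed
    have "eucl_norm (A ^\<^sub>m k *\<^sub>v z) \<le> real (dim_vec (A ^\<^sub>m k *\<^sub>v z)) * (real N * (c * r ^ k * eucl_norm z))"
      by (rule eucl_norm_le) (use entry Ak c r eucl_norm_nonneg[of z] in auto)
    then show ?thesis using A by (simp add: ac_simps)
  qed
  with that[of "real N * real N * c" r] c r show ?thesis by auto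
qed

lemma pow_mat_Suc_left:
  fixes A :: "'a :: semiring_1 mat"
  assumes A: "A \<in> carrier_mat n n"
  shows "A ^\<^sub>m Suc k = A * A ^\<^sub>m k"
proof (induction k)
  case 0
  then show ?case using A by simp
next
  case (Suc k)
  have "A ^\<^sub>m Suc (Suc k) = (A * A ^\<^sub>m k) * A" by (simp only: pow_mat.simps(2)[of A "Suc k"] Suc)
  also have "\<dots> = A * (A ^\<^sub>m k * A)" using A by (intro assoc_mult_mat[of _ n n _ n _ n]) auto
  finally show ?case by simp
qed

lemma origin_GAS_linear:
  assumes A: "A \<in> carrier_mat N N"
    and ev: "\<And>e. eigenvalue (map_mat complex_of_real A) e \<Longrightarrow> cmod e < 1"
    and f: "\<And>z. z \<in> carrier_vec N \<Longrightarrow> f z = A *\<^sub>v z"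
  shows "origin_GAS N f"
proof -
  obtain c r where c: "0 \<le> c" and r: "0 < r" "r < 1"
    and bound: "\<And>k z. z \<in> carrier_vec N \<Longrightarrow> eucl_norm (A ^\<^sub>m k *\<^sub>v z) \<le> c * r ^ k * eucl_norm z"
    by (rule mat_power_vec_geometric_bound[OF A ev]) auto
  have iter: "(f ^^ k) z = A ^\<^sub>m k *\<^sub>v z" if z: "z \<in> carrier_vec N" for k z
  proof -
    have "(f ^^ k) z \<in> carrier_vec N \<and> (f ^^ k) z = A ^\<^sub>m k *\<^sub>v z"
    proof (induction k)
      case 0
      then show ?case using z A by simp
    next
      case (Suc k)
      have "A ^\<^sub>m Suc k = A * A ^\<^sub>m k" by (rule pow_mat_Suc_left[OF A])
      moreover have Ak: "A ^\<^sub>m k \<in> carrier_mat N N" using A by simp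
      moreover have "A ^\<^sub>m k *\<^sub>v z \<in> carrier_vec N" using Ak z by (rule mult_mat_vec_carrier)
      ultimately show ?case using Suc z f[of "A ^\<^sub>m k *\<^sub>v z"] mult_mat_vec_carrier[OF A]
        by (simp add: assoc_mult_mat_vec[OF A Ak z] del: pow_mat.simps)
    qed
    then show ?thesis ..
  qed
  show ?thesis unfolding origin_GAS_def
  proof (intro conjI allI impI ballI)
    show "f (0\<^sub>v N) = 0\<^sub>v N" using f[of "0\<^sub>v N"] A by auto
  next
    fix \<epsilon> :: real assume \<epsilon>: "0 < \<epsilon>"
    show "\<exists>\<delta>>0. \<forall>z\<in>carrier_vec N. eucl_norm z < \<delta> \<longrightarrow> (\<forall>k. eucl_norm ((f ^^ k) z) < \<epsilon>)"
    proof (intro exI[of _ "\<epsilon> / (c + 1)"] conjI ballI impI allI)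
      fix z k assume z: "z \<in> carrier_vec N" and small: "eucl_norm z < \<epsilon> / (c + 1)"
      have "eucl_norm ((f ^^ k) z) \<le> c * r ^ k * eucl_norm z"
        unfolding iter[OF z] by (rule bound[OF z])
      also have "\<dots> \<le> (c + 1) * 1 * eucl_norm z"
        using c r eucl_norm_nonneg[of z] by (intro mult_mono) (auto intro: power_le_one)
      also have "\<dots> < \<epsilon>" using small c by (simp add: field_simps)
      finally show "eucl_norm ((f ^^ k) z) < \<epsilon>" .
    qed (use \<epsilon> c in auto)
  next
    fix z :: "real vec" assume z: "z \<in> carrier_vec N"
    have "(\<lambda>k. c * r ^ k * eucl_norm z) \<longlonglongrightarrow> c * 0 * eucl_norm z"
      using r by (intro tendsto_intros LIMSEQ_realpow_zero) auto
    then have lim: "(\<lambda>k. c * r ^ k * eucl_norm z) \<longlonglongrightarrow> 0" by simp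
    show "(\<lambda>k. eucl_norm ((f ^^ k) z)) \<longlonglongrightarrow> 0"
      unfolding iter[OF z]
      by (rule tendsto_sandwich[OF _ _ tendsto_const lim]) (simp_all add: eucl_norm_nonneg bound[OF z])
  qed
qed

section \<open>Block matrices acting on stacked vectors\<close>

text \<open>The index \<open>k\<close> runs through the blocks of length \<open>w\<close>: this splits the inner product of a row of a
  block matrix with a stacked vector into block products.\<close>

lemma sum_div_mod:
  fixes g :: "nat \<Rightarrow> nat \<Rightarrow> 'a :: comm_monoid_add"
  shows "(\<Sum>k<c * w. g (k div w) (k mod w)) = (\<Sum>j<c. \<Sum>t<w. g j t)"
proof -
  have "(\<Sum>k<c * w. g (k div w) (k mod w)) = (\<Sum>j<c. \<Sum>k=j * w..<j * w + w. g (k div w) (k mod w))"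
    by (rule sum.nat_group[symmetric])
  also have "\<dots> = (\<Sum>j<c. \<Sum>t<w. g j t)"
  proof (rule sum.cong[OF refl])
    fix j
    have "(\<Sum>k=j * w..<j * w + w. g (k div w) (k mod w)) =
        (\<Sum>t=0..<w. g ((t + j * w) div w) ((t + j * w) mod w))"
      using sum.shift_bounds_nat_ivl[of "\<lambda>k. g (k div w) (k mod w)" 0 "j * w" w]
      by (simp add: add.commute)
    also have "\<dots> = (\<Sum>t<w. g j t)"
      unfolding lessThan_atLeast0 by (rule sum.cong) auto
    finally show "(\<Sum>k=j * w..<j * w + w. g (k div w) (k mod w)) = (\<Sum>t<w. g j t)" .
  qed
  finally show ?thesis .
qed

lemma block_index:
  fixes i r h :: nat
  assumes "i < r * h"
  shows "i div h < r" "i mod h < h"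
  using assms by (auto simp: less_mult_imp_div_less intro!: mod_less_divisor gr0I)

lemma block_index_less:
  fixes i r h :: nat
  assumes "i < r" "a < h"
  shows "i * h + a < r * h"
proof -
  have "i * h + a < Suc i * h" using assms by simp
  also have "\<dots> \<le> r * h" using assms by (intro mult_right_mono) auto
  finally show ?thesis .
qed

lemma dim_stack_vec[simp]: "dim_vec (stack_vec r h f) = r * h"
  by (simp add: stack_vec_def)

lemma stack_vec_carrier[simp]: "stack_vec r h f \<in> carrier_vec (r * h)"
  by (simp add: carrier_vecI)

lemma stack_vec_index[simp]: "i < r * h \<Longrightarrow> stack_vec r h f $ i = f (i div h) $ (i mod h)"
  by (simp add: stack_vec_def)

lemma stack_vec_1: "v \<in> carrier_vec h \<Longrightarrow> stack_vec 1 h (\<lambda>_. v) = v"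
  by (auto intro!: eq_vecI)

lemma stack_vec_Suc:
  assumes "f r \<in> carrier_vec h"
  shows "stack_vec (Suc r) h f = stack_vec r h f @\<^sub>v f r"
proof (rule eq_vecI)
  fix i assume "i < dim_vec (stack_vec r h f @\<^sub>v f r)"
  then have i: "i < h + r * h" using assms by simp
  show "stack_vec (Suc r) h f $ i = (stack_vec r h f @\<^sub>v f r) $ i"
  proof (cases "i < r * h")
    case False
    define t where "t = i - r * h"
    have t: "t < h" "i = t + r * h" using i False by (auto simp: t_def)
    have "i div h = r" "i mod h = t" unfolding t(2) using t(1) by simp_all
    then show ?thesis using t assms by simp
  qed (use i assms in simp)
qed (use assms in simp)

lemma append_vec_assoc: "(a @\<^sub>v b) @\<^sub>v c = a @\<^sub>v b @\<^sub>v c"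
  by (auto intro!: eq_vecI)

lemma block_mat_carrier[simp]: "block_mat r c h w M \<in> carrier_mat (r * h) (c * w)"
  by (simp add: block_mat_def)

text \<open>Stated for one component, so that the zero blocks of Toeplitz, shift and companion matrices drop
  out of the sum.\<close>

lemma block_mat_mult_stack_vec:
  assumes M: "\<And>i j. i < r \<Longrightarrow> j < c \<Longrightarrow> M i j \<in> carrier_mat h w"
    and f: "\<And>j. j < c \<Longrightarrow> f j \<in> carrier_vec w"
    and i: "i < r * h"
  shows "(block_mat r c h w M *\<^sub>v stack_vec c w f) $ i =
    (\<Sum>j<c. (M (i div h) j *\<^sub>v f j) $ (i mod h))"
proof -
  note b = block_index[OF i]
  have "(block_mat r c h w M *\<^sub>v stack_vec c w f) $ i =
      (\<Sum>k<c * w. M (i div h) (k div w) $$ (i mod h, k mod w) * f (k div w) $ (k mod w))"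
    using i by (simp add: block_mat_def scalar_prod_def lessThan_atLeast0)
  also have "\<dots> = (\<Sum>j<c. \<Sum>t<w. M (i div h) j $$ (i mod h, t) * f j $ t)"
    by (rule sum_div_mod)
  also have "\<dots> = (\<Sum>j<c. (M (i div h) j *\<^sub>v f j) $ (i mod h))"
  proof (rule sum.cong[OF refl])
    fix j assume "j \<in> {..<c}"
    then show "(\<Sum>t<w. M (i div h) j $$ (i mod h, t) * f j $ t) = (M (i div h) j *\<^sub>v f j) $ (i mod h)"
      using M[OF b(1), of j] f[of j] b(2) by (auto simp: scalar_prod_def lessThan_atLeast0)
  qed
  finally show ?thesis .
qed

lemma append_cols_carrier[simp]:
  "M \<in> carrier_mat r c1 \<Longrightarrow> N \<in> carrier_mat r c2 \<Longrightarrow> append_cols M N \<in> carrier_mat r (c1 + c2)"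
  unfolding append_cols_def by auto

lemma append_cols_mult_append_vec:
  assumes M: "M \<in> carrier_mat r c1" and N: "N \<in> carrier_mat r c2"
    and a: "a \<in> carrier_vec c1" and b: "b \<in> carrier_vec c2"
  shows "append_cols M N *\<^sub>v (a @\<^sub>v b) = M *\<^sub>v a + N *\<^sub>v b"
proof -
  have "append_cols M N *\<^sub>v (a @\<^sub>v b) =
      (M *\<^sub>v a + N *\<^sub>v b) @\<^sub>v (0\<^sub>m 0 (dim_col M) *\<^sub>v a + 0\<^sub>m 0 (dim_col N) *\<^sub>v b)"
    unfolding append_cols_def by (rule four_block_mat_mult_vec) (use assms in auto)
  also have "\<dots> = M *\<^sub>v a + N *\<^sub>v b" using assms by (auto intro!: eq_vecI)
  finally show ?thesis .
qed

text \<open>The shift drops the oldest block and leaves a zero in the last place, where \<open>last_block\<close> inserts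
  the new one.\<close>

lemma shift_mat_stack_vec:
  assumes f: "\<And>i. i \<le> l \<Longrightarrow> f i \<in> carrier_vec h"
  shows "shift_mat l h *\<^sub>v stack_vec l h f + last_block l h *\<^sub>v f l = stack_vec l h (\<lambda>i. f (Suc i))"
proof (rule eq_vecI)
  fix i assume "i < dim_vec (stack_vec l h (\<lambda>i. f (Suc i)))"
  then have i: "i < l * h" by simp
  define b where "b = i div h"
  define a where "a = i mod h"
  have b: "b < l" and a: "a < h" using block_index[OF i] by (auto simp: a_def b_def)
  have "(shift_mat l h *\<^sub>v stack_vec l h f) $ i =
      (\<Sum>j<l. ((if j = Suc b then 1\<^sub>m h else 0\<^sub>m h h) *\<^sub>v f j) $ a)"
    using block_mat_mult_stack_vec[of l l "\<lambda>i j. if j = Suc i then 1\<^sub>m h else 0\<^sub>m h h" h h f i] f i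
    unfolding shift_mat_def a_def b_def by auto
  also have "\<dots> = (\<Sum>j<l. if j = Suc b then f j $ a else 0)"
    using f a by (intro sum.cong) auto
  also have "\<dots> = (if Suc b < l then f (Suc b) $ a else 0)" by simp
  finally have 1: "(shift_mat l h *\<^sub>v stack_vec l h f) $ i = \<dots>" .
  have 2: "(last_block l h *\<^sub>v f l) $ i = (if Suc b = l then f l $ a else 0)"
    using block_mat_mult_stack_vec[of l 1 "\<lambda>i _. if Suc i = l then 1\<^sub>m h else 0\<^sub>m h h" h h "\<lambda>_. f l" i]
      f[of l] i a
    unfolding last_block_def stack_vec_1[OF f[OF order_refl]] a_def b_def by auto
  show "(shift_mat l h *\<^sub>v stack_vec l h f + last_block l h *\<^sub>v f l) $ i = stack_vec l h (\<lambda>i. f (Suc i)) $ i"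
    using 1 2 i b by (auto simp: a_def b_def last_block_def block_mat_def)
qed (simp add: last_block_def block_mat_def)

text \<open>The matrices \<open>F\<close>, \<open>L\<close> and \<open>B\<close> of the auxiliary system move a window of \<open>l\<close> outputs and inputs one
  step ahead.\<close>

lemma aux_state_step:
  assumes y: "\<And>i. i \<le> l \<Longrightarrow> y i \<in> carrier_vec p" and u: "\<And>i. i \<le> l \<Longrightarrow> u i \<in> carrier_vec m"
  shows "aux_F p m l *\<^sub>v (stack_vec l p y @\<^sub>v stack_vec l m u) + aux_L p m l *\<^sub>v y l + aux_B p m l *\<^sub>v u l
    = stack_vec l p (\<lambda>i. y (Suc i)) @\<^sub>v stack_vec l m (\<lambda>i. u (Suc i))"
proof -
  have sh: "shift_mat l h \<in> carrier_mat (l * h) (l * h)" "last_block l h \<in> carrier_mat (l * h) h" for h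
    by (simp_all add: shift_mat_def last_block_def block_mat_def)
  have shv: "shift_mat l h *\<^sub>v stack_vec l h f \<in> carrier_vec (l * h)" for h f
    using sh(1) by (rule mult_mat_vec_carrier) simp
  have lbv: "v \<in> carrier_vec h \<Longrightarrow> last_block l h *\<^sub>v v \<in> carrier_vec (l * h)" for h v
    using sh(2) by (rule mult_mat_vec_carrier)
  have zv: "v \<in> carrier_vec h \<Longrightarrow> 0\<^sub>m r h *\<^sub>v v = 0\<^sub>v r" for r h and v :: "real vec"
    by (auto intro!: eq_vecI)
  have F: "aux_F p m l *\<^sub>v (stack_vec l p y @\<^sub>v stack_vec l m u) =
      (shift_mat l p *\<^sub>v stack_vec l p y) @\<^sub>v (shift_mat l m *\<^sub>v stack_vec l m u)"
    unfolding aux_F_def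
    by (subst four_block_mat_mult_vec[of _ "l * p" "l * p" _ "l * m" _ "l * m"])
       (use shv in \<open>simp_all add: sh zv\<close>)
  have L: "aux_L p m l *\<^sub>v y l = (last_block l p *\<^sub>v y l) @\<^sub>v 0\<^sub>v (l * m)"
    unfolding aux_L_def by (subst mat_mult_append[of _ "l * p" p _ "l * m"]) (simp_all add: sh zv y)
  have B: "aux_B p m l *\<^sub>v u l = 0\<^sub>v (l * p) @\<^sub>v (last_block l m *\<^sub>v u l)"
    unfolding aux_B_def by (subst mat_mult_append[of _ "l * p" m _ "l * m"]) (simp_all add: sh zv u)
  have "aux_F p m l *\<^sub>v (stack_vec l p y @\<^sub>v stack_vec l m u) + aux_L p m l *\<^sub>v y l + aux_B p m l *\<^sub>v u l
      = (shift_mat l p *\<^sub>v stack_vec l p y + last_block l p *\<^sub>v y l)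
        @\<^sub>v (shift_mat l m *\<^sub>v stack_vec l m u + last_block l m *\<^sub>v u l)"
    unfolding F L B using shv[of p y] shv[of m u] lbv[OF y, of l] lbv[OF u, of l]
    by (simp add: append_vec_add[of _ "l * p" _ _ "l * m"])
  then show ?thesis
    using shift_mat_stack_vec[of l y p] shift_mat_stack_vec[of l u m] y u by simp
qed

section \<open>Inverses\<close>

lemma inv_mat_inverse:
  assumes M: "M \<in> carrier_mat n n" and det: "det M \<noteq> 0"
  shows "inv_mat M \<in> carrier_mat n n" "inv_mat M * M = 1\<^sub>m n" "M * inv_mat M = 1\<^sub>m n"
proof -
  obtain B where "mat_inverse M = Some B"
    using mat_inverse(1)[OF M, of "()"] det_non_zero_imp_unit[OF M det, of "()"] by (cases "mat_inverse M") auto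
  with mat_inverse(2)[OF M this]
  show "inv_mat M \<in> carrier_mat n n" "inv_mat M * M = 1\<^sub>m n" "M * inv_mat M = 1\<^sub>m n"
    by (auto simp: inv_mat_def)
qed

lemma pos_def_mat_det_nonzero:
  assumes X: "pos_def_mat N X"
  shows "det X \<noteq> 0"
proof
  assume "det X = 0"
  with X obtain v where "v \<in> carrier_vec N" "v \<noteq> 0\<^sub>v N" "X *\<^sub>v v = 0\<^sub>v N"
    using det_0_iff_vec_prod_zero[of X N] by (auto simp: pos_def_mat_def)
  with X show False unfolding pos_def_mat_def by fastforce
qed

lemma det_nonzero_if_no_zero_eigenvalue:
  fixes S :: "real mat"
  assumes S: "S \<in> carrier_mat nw nw"
    and ev: "\<And>z. eigenvalue (map_mat complex_of_real S) z \<Longrightarrow> z \<noteq> 0"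
  shows "det S \<noteq> 0"
proof
  assume "det S = 0"
  then obtain v where v: "v \<in> carrier_vec nw" "v \<noteq> 0\<^sub>v nw" "S *\<^sub>v v = 0\<^sub>v nw"
    using det_0_iff_vec_prod_zero[OF S] by auto
  then have "S *\<^sub>v v = 0 \<cdot>\<^sub>v v" by auto
  with v S have "eigenvalue S 0" unfolding eigenvalue_def eigenvector_def by auto
  then have "eigenvalue (map_mat complex_of_real S) (complex_of_real 0)"
    by (rule of_real_hom.eigenvalue_hom[OF S])
  from ev[OF this] show False by simp
qed

section \<open>The output as a function of past inputs and outputs\<close>

locale plant_data =
  fixes S A B P C Q :: "real mat" and w x u y :: "nat \<Rightarrow> real vec" and n m p nw T :: nat
  assumes dims: "S \<in> carrier_mat nw nw" "A \<in> carrier_mat n n" "B \<in> carrier_mat n m"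
      "P \<in> carrier_mat n nw" "C \<in> carrier_mat p n" "Q \<in> carrier_mat p nw"
    and traj: "plant_trajectory T S A B P C Q w x u y"
begin

lemma dim:
  "dim_row S = nw" "dim_row A = n" "dim_col B = m" "dim_col P = nw" "dim_row C = p"
  using dims by auto

lemma trajectory_facts:
  shows "k \<le> T \<Longrightarrow> w (Suc k) = S *\<^sub>v w k"
    "k \<le> T \<Longrightarrow> x (Suc k) = A *\<^sub>v x k + B *\<^sub>v u k + P *\<^sub>v w k"
    "k \<le> T \<Longrightarrow> y k = C *\<^sub>v x k + Q *\<^sub>v w k"
    "k \<le> T \<Longrightarrow> u k \<in> carrier_vec m"
    "k \<le> Suc T \<Longrightarrow> w k \<in> carrier_vec nw"
    "k \<le> Suc T \<Longrightarrow> x k \<in> carrier_vec n"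
    "k \<le> T \<Longrightarrow> y k \<in> carrier_vec p"
proof -
  show step: "k \<le> T \<Longrightarrow> w (Suc k) = S *\<^sub>v w k"
    "k \<le> T \<Longrightarrow> x (Suc k) = A *\<^sub>v x k + B *\<^sub>v u k + P *\<^sub>v w k"
    "k \<le> T \<Longrightarrow> y k = C *\<^sub>v x k + Q *\<^sub>v w k"
    "k \<le> T \<Longrightarrow> u k \<in> carrier_vec m" for k
    using traj dims by (auto simp: plant_trajectory_def)
  show wc: "k \<le> Suc T \<Longrightarrow> w k \<in> carrier_vec nw" for k
    using traj dims by (induction k) (auto simp: step plant_trajectory_def)
  show xc: "k \<le> Suc T \<Longrightarrow> x k \<in> carrier_vec n" for k
  proof (induction k)
    case 0
    then show ?case using traj dims by (auto simp: plant_trajectory_def)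
  next
    case (Suc k)
    then show ?case using step(2,4)[of k] wc[of k] dims by auto
  qed
  show "k \<le> T \<Longrightarrow> y k \<in> carrier_vec p" using step(3)[of k] wc[of k] xc[of k] dims by auto
qed

text \<open>The variation-of-constants formula. It carries a general factor \<open>R\<close> because the induction on
  \<open>i\<close> passes from \<open>R\<close> to \<open>R A\<close>; the instances \<open>R = C\<close> and \<open>R = 1\<close> are the ones of interest.\<close>

lemma state_response:
  assumes "k + i \<le> Suc T" and R: "R \<in> carrier_mat r n" and a: "a < r"
  shows "(R *\<^sub>v x (k + i)) $ a = ((R * A ^\<^sub>m i) *\<^sub>v x k) $ a
    + (\<Sum>j<i. ((R * A ^\<^sub>m (i - j - 1) * B) *\<^sub>v u (k + j)) $ a)
    + (\<Sum>j<i. ((R * A ^\<^sub>m (i - j - 1) * P) *\<^sub>v w (k + j)) $ a)"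
  using assms(1) R
proof (induction i arbitrary: R)
  case 0
  then show ?case using dims by simp
next
  case (Suc i)
  have le: "k + i \<le> T" using Suc.prems by simp
  note R = Suc.prems(2)
  have RA: "R * A \<in> carrier_mat r n" using R dims by simp
  have pow: "R * A * A ^\<^sub>m j = R * A ^\<^sub>m Suc j" for j
    unfolding pow_mat_Suc_left[OF dims(2)] using R dims by (intro assoc_mult_mat[of _ r n _ n _ n]) auto
  note c = trajectory_facts(4)[OF le] trajectory_facts(5)[of "k + i"] trajectory_facts(6)[of "k + i"]
  have "R *\<^sub>v x (k + Suc i) = (R * A) *\<^sub>v x (k + i) + (R * B) *\<^sub>v u (k + i) + (R * P) *\<^sub>v w (k + i)"
    using trajectory_facts(2)[OF le] le c R dims
    by (simp add: mult_add_distrib_mat_vec[of _ r n] assoc_mult_mat_vec[of _ r n])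
  then have "(R *\<^sub>v x (k + Suc i)) $ a =
      ((R * A) *\<^sub>v x (k + i)) $ a + ((R * B) *\<^sub>v u (k + i)) $ a + ((R * P) *\<^sub>v w (k + i)) $ a"
    using a R dims by simp
  also have "((R * A) *\<^sub>v x (k + i)) $ a = ((R * A ^\<^sub>m Suc i) *\<^sub>v x k) $ a
      + (\<Sum>j<i. ((R * A ^\<^sub>m (Suc i - j - 1) * B) *\<^sub>v u (k + j)) $ a)
      + (\<Sum>j<i. ((R * A ^\<^sub>m (Suc i - j - 1) * P) *\<^sub>v w (k + j)) $ a)"
    unfolding Suc.IH[OF le_SucI[OF le] RA] pow
    by (intro arg_cong2[where f = "(+)"] sum.cong refl) (simp_all add: Suc_diff_Suc del: pow_mat.simps)
  finally show ?case using R dims by simp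
qed

lemma stacked_outputs:
  assumes le: "k + l \<le> Suc T"
  shows "stack_vec l p (\<lambda>i. y (k + i)) = obs_mat A C l *\<^sub>v x k
    + toep_u A B C l *\<^sub>v stack_vec l m (\<lambda>i. u (k + i))
    + toep_w A P C Q l *\<^sub>v stack_vec l nw (\<lambda>i. w (k + i))"
proof (rule eq_vecI)
  fix i assume "i < dim_vec (obs_mat A C l *\<^sub>v x k
    + toep_u A B C l *\<^sub>v stack_vec l m (\<lambda>i. u (k + i))
    + toep_w A P C Q l *\<^sub>v stack_vec l nw (\<lambda>i. w (k + i)))"
  then have i: "i < l * p" using dims by (simp add: toep_w_def block_mat_def)
  define b where "b = i div p"
  define a where "a = i mod p"
  have b: "b < l" and a: "a < p" using block_index[OF i] by (auto simp: a_def b_def)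
  have xk: "x k \<in> carrier_vec n" using le by (intro trajectory_facts) auto
  have uk: "\<And>j. j < l \<Longrightarrow> u (k + j) \<in> carrier_vec m" using le by (intro trajectory_facts) auto
  have wk: "\<And>j. j < l \<Longrightarrow> w (k + j) \<in> carrier_vec nw" using le by (intro trajectory_facts) auto
  have O: "(obs_mat A C l *\<^sub>v x k) $ i = ((C * A ^\<^sub>m b) *\<^sub>v x k) $ a"
    using block_mat_mult_stack_vec[of l 1 "\<lambda>i _. C * A ^\<^sub>m i" p n "\<lambda>_. x k" i] xk i dims dim
    unfolding obs_mat_def stack_vec_1[OF xk] a_def b_def by simp
  have "(toep_u A B C l *\<^sub>v stack_vec l m (\<lambda>i. u (k + i))) $ i =
      (\<Sum>j<l. ((if j < b then C * A ^\<^sub>m (b - j - 1) * B else 0\<^sub>m p m) *\<^sub>v u (k + j)) $ a)"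
    unfolding toep_u_def dim a_def b_def
    by (rule block_mat_mult_stack_vec) (use uk i dims in auto)
  also have "\<dots> = (\<Sum>j<b. ((C * A ^\<^sub>m (b - j - 1) * B) *\<^sub>v u (k + j)) $ a)"
    using b a uk by (intro sum.mono_neutral_cong_right) auto
  finally have U: "(toep_u A B C l *\<^sub>v stack_vec l m (\<lambda>i. u (k + i))) $ i = \<dots>" .
  have "(toep_w A P C Q l *\<^sub>v stack_vec l nw (\<lambda>i. w (k + i))) $ i =
      (\<Sum>j<l. ((if j < b then C * A ^\<^sub>m (b - j - 1) * P else if b = j then Q else 0\<^sub>m p nw)
        *\<^sub>v w (k + j)) $ a)"
    unfolding toep_w_def dim a_def b_def
    by (rule block_mat_mult_stack_vec) (use wk i dims in auto)
  also have "\<dots> = (\<Sum>j<Suc b. ((if j < b then C * A ^\<^sub>m (b - j - 1) * P else Q) *\<^sub>v w (k + j)) $ a)"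
    using b a wk by (intro sum.mono_neutral_cong_right) auto
  also have "\<dots> = (\<Sum>j<b. ((C * A ^\<^sub>m (b - j - 1) * P) *\<^sub>v w (k + j)) $ a) + (Q *\<^sub>v w (k + b)) $ a"
    by simp
  finally have W: "(toep_w A P C Q l *\<^sub>v stack_vec l nw (\<lambda>i. w (k + i))) $ i = \<dots>" .
  have "stack_vec l p (\<lambda>i. y (k + i)) $ i = (C *\<^sub>v x (k + b)) $ a + (Q *\<^sub>v w (k + b)) $ a"
    using i b a le trajectory_facts(3)[of "k + b"] dims unfolding a_def b_def by simp
  also have "\<dots> = (obs_mat A C l *\<^sub>v x k) $ i + (toep_u A B C l *\<^sub>v stack_vec l m (\<lambda>i. u (k + i))) $ i
      + (toep_w A P C Q l *\<^sub>v stack_vec l nw (\<lambda>i. w (k + i))) $ i"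
    unfolding O U W using state_response[OF _ dims(5) a, of k b] b le by simp
  finally show "stack_vec l p (\<lambda>i. y (k + i)) $ i = (obs_mat A C l *\<^sub>v x k
    + toep_u A B C l *\<^sub>v stack_vec l m (\<lambda>i. u (k + i))
    + toep_w A P C Q l *\<^sub>v stack_vec l nw (\<lambda>i. w (k + i))) $ i"
    using i dims by (simp add: toep_u_def toep_w_def obs_mat_def block_mat_def)
qed (use dims in \<open>simp add: toep_w_def block_mat_def\<close>)

lemma state_from_past_inputs:
  assumes le: "k + l \<le> Suc T"
  shows "x (k + l) = A ^\<^sub>m l *\<^sub>v x k + reach_mat A B l *\<^sub>v stack_vec l m (\<lambda>i. u (k + i))
    + reach_mat A P l *\<^sub>v stack_vec l nw (\<lambda>i. w (k + i))"
proof (rule eq_vecI)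
  have xk: "x k \<in> carrier_vec n" using le by (intro trajectory_facts) auto
  have xl: "x (k + l) \<in> carrier_vec n" using le by (intro trajectory_facts) auto
  have uk: "\<And>j. j < l \<Longrightarrow> u (k + j) \<in> carrier_vec m" using le by (intro trajectory_facts) auto
  have wk: "\<And>j. j < l \<Longrightarrow> w (k + j) \<in> carrier_vec nw" using le by (intro trajectory_facts) auto
  show "dim_vec (x (k + l)) = dim_vec (A ^\<^sub>m l *\<^sub>v x k
      + reach_mat A B l *\<^sub>v stack_vec l m (\<lambda>i. u (k + i))
      + reach_mat A P l *\<^sub>v stack_vec l nw (\<lambda>i. w (k + i)))"
    using xl dims by (simp add: reach_mat_def block_mat_def)
  fix i assume "i < dim_vec (A ^\<^sub>m l *\<^sub>v x k
      + reach_mat A B l *\<^sub>v stack_vec l m (\<lambda>i. u (k + i))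
      + reach_mat A P l *\<^sub>v stack_vec l nw (\<lambda>i. w (k + i)))"
  then have i: "i < n" using dims by (simp add: reach_mat_def block_mat_def)
  have pow: "1\<^sub>m n * A ^\<^sub>m j = A ^\<^sub>m j" for j using dims by simp
  have U: "(reach_mat A B l *\<^sub>v stack_vec l m (\<lambda>i. u (k + i))) $ i =
      (\<Sum>j<l. ((A ^\<^sub>m (l - j - 1) * B) *\<^sub>v u (k + j)) $ i)"
    unfolding reach_mat_def dim
    by (subst block_mat_mult_stack_vec) (use uk i dims in \<open>auto simp: diff_commute\<close>)
  have W: "(reach_mat A P l *\<^sub>v stack_vec l nw (\<lambda>i. w (k + i))) $ i =
      (\<Sum>j<l. ((A ^\<^sub>m (l - j - 1) * P) *\<^sub>v w (k + j)) $ i)"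
    unfolding reach_mat_def dim
    by (subst block_mat_mult_stack_vec) (use wk i dims in \<open>auto simp: diff_commute\<close>)
  have "x (k + l) $ i = (1\<^sub>m n *\<^sub>v x (k + l)) $ i" using xl by simp
  also have "\<dots> = (A ^\<^sub>m l *\<^sub>v x k) $ i + (reach_mat A B l *\<^sub>v stack_vec l m (\<lambda>i. u (k + i))) $ i
      + (reach_mat A P l *\<^sub>v stack_vec l nw (\<lambda>i. w (k + i))) $ i"
    unfolding U W state_response[OF le one_carrier_mat i] pow ..
  finally show "x (k + l) $ i = (A ^\<^sub>m l *\<^sub>v x k
      + reach_mat A B l *\<^sub>v stack_vec l m (\<lambda>i. u (k + i))
      + reach_mat A P l *\<^sub>v stack_vec l nw (\<lambda>i. w (k + i))) $ i"
    using i dims by (simp add: reach_mat_def block_mat_def)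
qed

lemma aux_carriers:
  "obs_mat A C l \<in> carrier_mat (l * p) n"
  "toep_u A B C l \<in> carrier_mat (l * p) (l * m)"
  "toep_w A P C Q l \<in> carrier_mat (l * p) (l * nw)"
  "reach_mat A B l \<in> carrier_mat n (l * m)"
  "reach_mat A P l \<in> carrier_mat n (l * nw)"
  using dims by (simp_all add: obs_mat_def toep_u_def toep_w_def reach_mat_def block_mat_def)

text \<open>The stacked outputs determine \<open>x k\<close> through the left inverse \<open>OL\<close> up to the effect of the past
  inputs and exosignal values, and \<open>x k\<close> with these inputs determines \<open>x (k + l)\<close>. The matrices \<open>Z1\<close> and
  \<open>Z2\<close> collect the coefficients that result.\<close>

lemma output_from_past:
  assumes le: "k + l \<le> T"
    and OL: "OL \<in> carrier_mat n (l * p)" "OL * obs_mat A C l = 1\<^sub>m n"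
  shows "y (k + l) =
    aux_Z1 A B C OL l *\<^sub>v (stack_vec l p (\<lambda>i. y (k + i)) @\<^sub>v stack_vec l m (\<lambda>i. u (k + i)))
    + aux_Z2 A P C Q OL l *\<^sub>v stack_vec (Suc l) nw (\<lambda>i. w (k + i))"
proof -
  let ?ys = "stack_vec l p (\<lambda>i. y (k + i))"
  let ?us = "stack_vec l m (\<lambda>i. u (k + i))"
  let ?ws = "stack_vec l nw (\<lambda>i. w (k + i))"
  let ?O = "obs_mat A C l"
  let ?Tu = "toep_u A B C l"
  let ?Tw = "toep_w A P C Q l"
  let ?Ru = "reach_mat A B l"
  let ?Rw = "reach_mat A P l"
  define M where "M = C * A ^\<^sub>m l * OL"
  have CA: "C * A ^\<^sub>m l \<in> carrier_mat p n" using dims by simp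
  have M: "M \<in> carrier_mat p (l * p)" unfolding M_def using CA OL by simp
  have xk: "x k \<in> carrier_vec n" using le by (intro trajectory_facts) auto
  have wl: "w (k + l) \<in> carrier_vec nw" using le by (intro trajectory_facts) auto
  note ac = aux_carriers[of l]
  have MO: "M *\<^sub>v (?O *\<^sub>v x k) = (C * A ^\<^sub>m l) *\<^sub>v x k"
  proof -
    have "M *\<^sub>v (?O *\<^sub>v x k) = (M * ?O) *\<^sub>v x k" using M ac xk by simp
    also have "M * ?O = C * A ^\<^sub>m l * (OL * ?O)"
      unfolding M_def by (rule assoc_mult_mat[OF CA OL(1) ac(1)])
    also have "C * A ^\<^sub>m l * (OL * ?O) = C * A ^\<^sub>m l" unfolding OL(2) by (rule right_mult_one_mat[OF CA])
    finally show ?thesis .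
  qed
  have Mys: "M *\<^sub>v ?ys = (C * A ^\<^sub>m l) *\<^sub>v x k + (M * ?Tu) *\<^sub>v ?us + (M * ?Tw) *\<^sub>v ?ws"
    using stacked_outputs[of k l] le M ac xk
    by (simp add: mult_add_distrib_mat_vec[of _ p "l * p"] MO)
  have Cx: "C *\<^sub>v x (k + l) = (C * A ^\<^sub>m l) *\<^sub>v x k + (C * ?Ru) *\<^sub>v ?us + (C * ?Rw) *\<^sub>v ?ws"
  proof -
    have "A ^\<^sub>m l *\<^sub>v x k \<in> carrier_vec n" using dims xk by (intro mult_mat_vec_carrier) auto
    moreover have "?Ru *\<^sub>v ?us \<in> carrier_vec n" "?Rw *\<^sub>v ?ws \<in> carrier_vec n"
      using ac by (auto intro!: mult_mat_vec_carrier)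
    ultimately show ?thesis
      using state_from_past_inputs[of k l] le ac xk dims
      by (simp add: mult_add_distrib_mat_vec[of _ p n] assoc_mult_mat_vec[of C p n "A ^\<^sub>m l" n]
          del: assoc_add_vec)
  qed
  have Z1: "aux_Z1 A B C OL l *\<^sub>v (?ys @\<^sub>v ?us) = M *\<^sub>v ?ys + (C * ?Ru - M * ?Tu) *\<^sub>v ?us"
    unfolding aux_Z1_def M_def[symmetric]
    by (rule append_cols_mult_append_vec[of _ p "l * p" _ "l * m"]) (use M ac dims in auto)
  have Z2: "aux_Z2 A P C Q OL l *\<^sub>v (?ws @\<^sub>v w (k + l)) = (C * ?Rw - M * ?Tw) *\<^sub>v ?ws + Q *\<^sub>v w (k + l)"
    unfolding aux_Z2_def M_def[symmetric]
    by (rule append_cols_mult_append_vec[of _ p "l * nw" _ nw]) (use M ac dims wl in auto)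
  have d1: "(C * ?Ru - M * ?Tu) *\<^sub>v ?us = (C * ?Ru) *\<^sub>v ?us - (M * ?Tu) *\<^sub>v ?us"
    by (rule minus_mult_distrib_mat_vec[of _ p "l * m"]) (use M ac dims in auto)
  have d2: "(C * ?Rw - M * ?Tw) *\<^sub>v ?ws = (C * ?Rw) *\<^sub>v ?ws - (M * ?Tw) *\<^sub>v ?ws"
    by (rule minus_mult_distrib_mat_vec[of _ p "l * nw"]) (use M ac dims in auto)
  have dr: "dim_row M = p" "dim_row C = p" "dim_row Q = p" using M dims by auto
  have carr: "(C * A ^\<^sub>m l) *\<^sub>v x k \<in> carrier_vec p" "(M * ?Tu) *\<^sub>v ?us \<in> carrier_vec p"
     "(M * ?Tw) *\<^sub>v ?ws \<in> carrier_vec p" "(C * ?Ru) *\<^sub>v ?us \<in> carrier_vec p"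
     "(C * ?Rw) *\<^sub>v ?ws \<in> carrier_vec p" "Q *\<^sub>v w (k + l) \<in> carrier_vec p"
    by (rule carrier_vecI, simp add: dr)+
  \<comment> \<open>The past outputs carry the Toeplitz terms \<open>e2\<close> and \<open>e3\<close>, which \<open>Z1\<close> and \<open>Z2\<close> subtract again.\<close>
  have cancel: "e1 + e4 + e5 + e6 = e1 + e2 + e3 + (e4 - e2) + (e5 - e3 + e6)"
    if "e1 \<in> carrier_vec p" "e2 \<in> carrier_vec p" "e3 \<in> carrier_vec p"
      "e4 \<in> carrier_vec p" "e5 \<in> carrier_vec p" "e6 \<in> carrier_vec p" for e1 e2 e3 e4 e5 e6 :: "real vec"
    using that by (intro eq_vecI) auto
  show ?thesis
    unfolding stack_vec_Suc[of "\<lambda>i. w (k + i)" l, OF wl] Z1 Z2 d1 d2 Mys trajectory_facts(3)[OF le] Cx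
    by (rule cancel[OF carr])
qed

text \<open>The past of the exosignal is a function of its present value, since its dynamics can be run
  backwards.\<close>

lemma exo_stack_mult:
  assumes le: "k + l \<le> Suc T" and det: "det S \<noteq> 0"
  shows "exo_stack S l *\<^sub>v w (k + l) = stack_vec (Suc l) nw (\<lambda>i. w (k + i))"
proof -
  note inv = inv_mat_inverse[OF dims(1) det]
  have rewind: "inv_mat S ^\<^sub>m j *\<^sub>v w (i + j) = w i" if "i + j \<le> Suc T" for i j
    using that
  proof (induction j)
    case 0
    then show ?case using inv trajectory_facts(5)[of i] by simp
  next
    case (Suc j)
    have wj: "w (i + j) \<in> carrier_vec nw" using Suc.prems by (intro trajectory_facts) auto
    have pj: "inv_mat S ^\<^sub>m j \<in> carrier_mat nw nw" using inv by simp
    have "inv_mat S *\<^sub>v (S *\<^sub>v w (i + j)) = (inv_mat S * S) *\<^sub>v w (i + j)"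
      using inv(1) dims(1) wj by simp
    then have "inv_mat S *\<^sub>v (S *\<^sub>v w (i + j)) = w (i + j)" using inv(2) wj by simp
    then show ?case using Suc pj inv(1) dims(1) wj trajectory_facts(1)[of "i + j"]
      by (simp add: assoc_mult_mat_vec[of _ nw nw _ nw])
  qed
  have wl: "w (k + l) \<in> carrier_vec nw" using le by (intro trajectory_facts) auto
  show ?thesis
  proof (rule eq_vecI)
    fix i assume "i < dim_vec (stack_vec (Suc l) nw (\<lambda>i. w (k + i)))"
    then have i: "i < Suc l * nw" by simp
    have b: "i div nw < Suc l" using block_index[OF i] by simp
    have "(exo_stack S l *\<^sub>v w (k + l)) $ i = (inv_mat S ^\<^sub>m (l - i div nw) *\<^sub>v w (k + l)) $ (i mod nw)"
      using block_mat_mult_stack_vec[of "Suc l" 1 "\<lambda>i _. inv_mat S ^\<^sub>m (l - i)" nw nw "\<lambda>_. w (k + l)" i]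
        wl i dims inv unfolding exo_stack_def stack_vec_1[OF wl] by simp
    also have "\<dots> = w (k + i div nw) $ (i mod nw)"
      using rewind[of "k + i div nw" "l - i div nw"] b le by simp
    finally show "(exo_stack S l *\<^sub>v w (k + l)) $ i = stack_vec (Suc l) nw (\<lambda>i. w (k + i)) $ i"
      using i by simp
  qed (use dims in \<open>simp add: exo_stack_def block_mat_def\<close>)
qed

end

section \<open>The closed loop expressed by data\<close>

text \<open>The auxiliary system in series with the internal model, as one linear system in the stacked state.
  Both the recorded data and the closed loop are instances.\<close>

lemma stacked_step:
  fixes AA BB Lw G Z1 Zs \<Phi> :: "real mat"
  assumes dims: "AA \<in> carrier_mat a a" "BB \<in> carrier_mat a m" "Lw \<in> carrier_mat a nw"
      "\<Phi> \<in> carrier_mat b b" "G \<in> carrier_mat b p" "Z1 \<in> carrier_mat p a" "Zs \<in> carrier_mat p nw"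
    and vecs: "\<xi> \<in> carrier_vec a" "\<mu> \<in> carrier_vec b" "v \<in> carrier_vec m" "\<omega> \<in> carrier_vec nw"
  shows "(AA *\<^sub>v \<xi> + BB *\<^sub>v v + Lw *\<^sub>v \<omega>) @\<^sub>v (\<Phi> *\<^sub>v \<mu> + G *\<^sub>v (Z1 *\<^sub>v \<xi> + Zs *\<^sub>v \<omega>)) =
    four_block_mat AA (0\<^sub>m a b) (G * Z1) \<Phi> *\<^sub>v (\<xi> @\<^sub>v \<mu>) + (BB @\<^sub>r 0\<^sub>m b m) *\<^sub>v v
      + (Lw @\<^sub>r (G * Zs)) *\<^sub>v \<omega>"
proof -
  have zv: "v \<in> carrier_vec h \<Longrightarrow> 0\<^sub>m r h *\<^sub>v v = 0\<^sub>v r" for r h and v :: "real vec"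
    by (auto intro!: eq_vecI)
  have carr: "AA *\<^sub>v \<xi> \<in> carrier_vec a" "BB *\<^sub>v v \<in> carrier_vec a" "Lw *\<^sub>v \<omega> \<in> carrier_vec a"
    "\<Phi> *\<^sub>v \<mu> \<in> carrier_vec b" "G *\<^sub>v (Z1 *\<^sub>v \<xi>) \<in> carrier_vec b" "G *\<^sub>v (Zs *\<^sub>v \<omega>) \<in> carrier_vec b"
    "Z1 *\<^sub>v \<xi> \<in> carrier_vec p" "Zs *\<^sub>v \<omega> \<in> carrier_vec p"
    using dims vecs by (auto intro!: mult_mat_vec_carrier)
  have 1: "four_block_mat AA (0\<^sub>m a b) (G * Z1) \<Phi> *\<^sub>v (\<xi> @\<^sub>v \<mu>) =
      (AA *\<^sub>v \<xi>) @\<^sub>v (G *\<^sub>v (Z1 *\<^sub>v \<xi>) + \<Phi> *\<^sub>v \<mu>)"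
    by (subst four_block_mat_mult_vec[of _ a a _ b _ b])
       (use dims vecs carr in \<open>simp_all add: zv assoc_mult_mat_vec[of G b p Z1 a]\<close>)
  have 2: "(BB @\<^sub>r 0\<^sub>m b m) *\<^sub>v v = (BB *\<^sub>v v) @\<^sub>v 0\<^sub>v b"
    by (subst mat_mult_append[of _ a m _ b]) (use dims vecs in \<open>simp_all add: zv\<close>)
  have 3: "(Lw @\<^sub>r (G * Zs)) *\<^sub>v \<omega> = (Lw *\<^sub>v \<omega>) @\<^sub>v (G *\<^sub>v (Zs *\<^sub>v \<omega>))"
    by (subst mat_mult_append[of _ a nw _ b])
       (use dims vecs in \<open>simp_all add: assoc_mult_mat_vec[of G b p Zs nw]\<close>)
  have 4: "G *\<^sub>v (Z1 *\<^sub>v \<xi> + Zs *\<^sub>v \<omega>) = G *\<^sub>v (Z1 *\<^sub>v \<xi>) + G *\<^sub>v (Zs *\<^sub>v \<omega>)"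
    using dims carr by (intro mult_add_distrib_mat_vec[of _ b p]) auto
  show ?thesis
    unfolding 1 2 3 4 using carr
    by (simp add: append_vec_add[of _ a _ _ b]) (auto intro!: eq_vecI)
qed

lemma mat_eq_by_mult_vec:
  fixes M M' :: "'a :: semiring_1 mat"
  assumes M: "M \<in> carrier_mat r c" "M' \<in> carrier_mat r c"
    and eq: "\<And>v. v \<in> carrier_vec c \<Longrightarrow> M *\<^sub>v v = M' *\<^sub>v v"
  shows "M = M'"
proof (rule mat_col_eqI)
  fix j assume "j < dim_col M'"
  then have j: "j < c" using M by simp
  have "col M j = M *\<^sub>v unit_vec c j" "col M' j = M' *\<^sub>v unit_vec c j"
    using M j col_mult2[OF M(1) one_carrier_mat j] col_mult2[OF M(2) one_carrier_mat j] by simp_all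
  then show "col M j = col M' j" using eq[of "unit_vec c j"] by simp
qed (use M in auto)

text \<open>The equality constraint splits into \<open>\<Psi>0 Y = X\<close> and \<open>M Y = 0\<close>: the columns of \<open>Y\<close> combine
  the recorded states into the columns of \<open>X\<close> and cancel the contribution of the exosignal, while the recorded
  inputs are combined into \<open>U1 Y\<close>, which is the feedback gain times \<open>X\<close>.\<close>

lemma sdp_feasible_closed_loop:
  assumes feas: "sdp_feasible N c nh \<Psi>0 \<Psi>1 M X Y"
    and dims: "\<Psi>0 \<in> carrier_mat N c" "M \<in> carrier_mat nh c" "U1 \<in> carrier_mat m c"
      "A0 \<in> carrier_mat N N" "B0 \<in> carrier_mat N m" "D \<in> carrier_mat N nw" "L \<in> carrier_mat nw nh"
    and \<Psi>1: "\<Psi>1 = A0 * \<Psi>0 + B0 * U1 + D * (L * M)"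
  shows "\<Psi>1 * Y = (A0 + B0 * (U1 * Y * inv_mat X)) * X"
proof -
  have Y: "Y \<in> carrier_mat c N" and Xpd: "pos_def_mat N X"
    and eq: "X @\<^sub>r 0\<^sub>m nh N = (\<Psi>0 @\<^sub>r M) * Y"
    using feas by (auto simp: sdp_feasible_def)
  have X: "X \<in> carrier_mat N N" using Xpd by (simp add: pos_def_mat_def)
  note inv = inv_mat_inverse[OF X pos_def_mat_det_nonzero[OF Xpd]]
  have vecs: "\<Psi>0 *\<^sub>v (Y *\<^sub>v v) = X *\<^sub>v v \<and> M *\<^sub>v (Y *\<^sub>v v) = 0\<^sub>v nh" if v: "v \<in> carrier_vec N" for v
  proof -
    have Yv: "Y *\<^sub>v v \<in> carrier_vec c" using Y v by (rule mult_mat_vec_carrier)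
    have "(X *\<^sub>v v) @\<^sub>v (0\<^sub>m nh N *\<^sub>v v) = (X @\<^sub>r 0\<^sub>m nh N) *\<^sub>v v"
      by (rule mat_mult_append[OF X zero_carrier_mat v, symmetric])
    also have "\<dots> = (\<Psi>0 @\<^sub>r M) *\<^sub>v (Y *\<^sub>v v)"
      unfolding eq by (rule assoc_mult_mat_vec[OF _ Y v]) (use dims in auto)
    also have "\<dots> = (\<Psi>0 *\<^sub>v (Y *\<^sub>v v)) @\<^sub>v (M *\<^sub>v (Y *\<^sub>v v))"
      by (rule mat_mult_append[OF dims(1,2) Yv])
    finally have "X *\<^sub>v v = \<Psi>0 *\<^sub>v (Y *\<^sub>v v) \<and> 0\<^sub>m nh N *\<^sub>v v = M *\<^sub>v (Y *\<^sub>v v)"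
      by (subst (asm) append_vec_eq[of _ N]) (use X dims v Yv in \<open>auto intro!: mult_mat_vec_carrier\<close>)
    moreover have "0\<^sub>m nh N *\<^sub>v v = 0\<^sub>v nh" using v by (auto intro!: eq_vecI)
    ultimately show ?thesis by simp
  qed
  have P0Y: "\<Psi>0 * Y = X"
    by (rule mat_eq_by_mult_vec[of _ N N]) (use dims Y X vecs in auto)
  have MY: "M * Y = 0\<^sub>m nh N"
    by (rule mat_eq_by_mult_vec[of _ nh N]) (use dims Y vecs in \<open>auto intro!: eq_vecI\<close>)
  have KX: "U1 * Y * inv_mat X * X = U1 * Y"
  proof -
    have "U1 * Y * inv_mat X * X = U1 * Y * (inv_mat X * X)"
      by (rule assoc_mult_mat[of _ m N _ N _ N]) (use dims Y X inv in auto)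
    then show ?thesis using inv(2) dims Y by simp
  qed
  have "\<Psi>1 * Y = A0 * \<Psi>0 * Y + B0 * U1 * Y + D * (L * M) * Y"
    unfolding \<Psi>1 using dims Y by (simp add: add_mult_distrib_mat[of _ N c _ _ N])
  also have "A0 * \<Psi>0 * Y = A0 * X"
    using dims Y by (simp add: P0Y assoc_mult_mat[of A0 N N \<Psi>0 c Y N])
  also have "B0 * U1 * Y = B0 * (U1 * Y)"
    using dims Y by (simp add: assoc_mult_mat[of B0 N m U1 c Y N])
  also have "D * (L * M) * Y = 0\<^sub>m N N"
  proof -
    have "D * (L * M) * Y = D * (L * (M * Y))"
      using dims Y by (simp add: assoc_mult_mat[of D N nw "L * M" c Y N] assoc_mult_mat[of L nw nh M c Y N])
    then show ?thesis unfolding MY using dims by simp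
  qed
  also have "A0 * X + B0 * (U1 * Y) + 0\<^sub>m N N = A0 * X + B0 * (U1 * Y * inv_mat X * X)"
    unfolding KX using dims X Y by simp
  also have "B0 * (U1 * Y * inv_mat X * X) = B0 * (U1 * Y * inv_mat X) * X"
    by (rule assoc_mult_mat[symmetric, of _ N m _ N _ N]) (use dims Y X inv in auto)
  also have "A0 * X + B0 * (U1 * Y * inv_mat X) * X = (A0 + B0 * (U1 * Y * inv_mat X)) * X"
    by (rule add_mult_distrib_mat[symmetric, of _ N N _ _ N]) (use dims Y X inv in auto)
  finally show ?thesis .
qed

lemma data_mat_carrier: "data_mat h f a b \<in> carrier_mat h (Suc b - a)"
  by (simp add: data_mat_def mat_of_cols_def del: upt_Suc)

lemma data_mat_index: "i < h \<Longrightarrow> j < Suc b - a \<Longrightarrow> data_mat h f a b $$ (i, j) = f (a + j) $ i"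
  by (simp add: data_mat_def mat_of_cols_index del: upt_Suc)

lemma mult_data_mat_index:
  assumes M: "M \<in> carrier_mat r h" and i: "i < r" and j: "j < Suc b - a" and f: "f (a + j) \<in> carrier_vec h"
  shows "(M * data_mat h f a b) $$ (i, j) = (M *\<^sub>v f (a + j)) $ i"
proof -
  have "col (data_mat h f a b) j = f (a + j)"
    using j f by (intro eq_vecI) (auto simp: data_mat_def mat_of_cols_index simp del: upt_Suc)
  then show ?thesis using M i j by (simp add: data_mat_def del: upt_Suc)
qed

lemma data_mat_recursion:
  assumes dims: "A0 \<in> carrier_mat N N" "B0 \<in> carrier_mat N m" "D \<in> carrier_mat N nw"
    and f: "\<And>k. l \<le> k \<Longrightarrow> k \<le> T \<Longrightarrow> \<psi> k \<in> carrier_vec N \<and> u k \<in> carrier_vec m \<and> w k \<in> carrier_vec nw"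
    and step: "\<And>k. l \<le> k \<Longrightarrow> k \<le> T \<Longrightarrow> \<psi> (Suc k) = A0 *\<^sub>v \<psi> k + B0 *\<^sub>v u k + D *\<^sub>v w k"
  shows "data_mat N \<psi> (l + 1) (T + 1) =
    A0 * data_mat N \<psi> l T + B0 * data_mat m u l T + D * data_mat nw w l T"
proof (rule eq_matI)
  fix i j assume "i < dim_row (A0 * data_mat N \<psi> l T + B0 * data_mat m u l T + D * data_mat nw w l T)"
    "j < dim_col (A0 * data_mat N \<psi> l T + B0 * data_mat m u l T + D * data_mat nw w l T)"
  then have i: "i < N" and j: "j < Suc T - l" using dims by (auto simp: data_mat_def simp del: upt_Suc)
  have k: "l \<le> l + j" "l + j \<le> T" using j by auto
  have "data_mat N \<psi> (l + 1) (T + 1) $$ (i, j) = \<psi> (Suc (l + j)) $ i"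
    using data_mat_index[of i N j "T + 1" "l + 1" \<psi>] i j by simp
  also have "\<dots> = (A0 *\<^sub>v \<psi> (l + j)) $ i + (B0 *\<^sub>v u (l + j)) $ i + (D *\<^sub>v w (l + j)) $ i"
    using step[OF k] dims i by simp
  also have "\<dots> = (A0 * data_mat N \<psi> l T) $$ (i, j) + (B0 * data_mat m u l T) $$ (i, j)
      + (D * data_mat nw w l T) $$ (i, j)"
    using mult_data_mat_index[OF dims(1) i j, of \<psi>] mult_data_mat_index[OF dims(2) i j, of u]
      mult_data_mat_index[OF dims(3) i j, of w] f[OF k] by simp
  finally show "data_mat N \<psi> (l + 1) (T + 1) $$ (i, j) =
      (A0 * data_mat N \<psi> l T + B0 * data_mat m u l T + D * data_mat nw w l T) $$ (i, j)"
    using i j dims by (simp add: data_mat_def del: upt_Suc)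
qed (use dims in \<open>simp_all add: data_mat_def del: upt_Suc\<close>)

context plant_data
begin

text \<open>The window of past data moves by \<open>aux_state_step\<close>, and the output that enters it is the one
  predicted by \<open>output_from_past\<close>. So the recorded vectors are a trajectory of the auxiliary system in series
  with the internal model, whatever the initial state of the plant.\<close>

lemma data_vec_step:
  assumes le: "k + l \<le> T" and det: "det S \<noteq> 0"
    and OL: "OL \<in> carrier_mat n (l * p)" "OL * obs_mat A C l = 1\<^sub>m n"
    and \<Phi>: "\<Phi> \<in> carrier_mat b b" and G: "G \<in> carrier_mat b p"
    and \<eta>: "\<eta> (k + l) \<in> carrier_vec b" "\<eta> (Suc (k + l)) = \<Phi> *\<^sub>v \<eta> (k + l) + G *\<^sub>v y (k + l)"
    and Z1: "Z1 = aux_Z1 A B C OL l" "Z1 \<in> carrier_mat p a"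
    and Z2: "Z2 = aux_Z2 A P C Q OL l" "Z2 \<in> carrier_mat p r"
    and SS: "SS = exo_stack S l" "SS \<in> carrier_mat r nw"
    and F: "aux_F p m l \<in> carrier_mat a a" and L: "aux_L p m l \<in> carrier_mat a p"
    and B: "aux_B p m l \<in> carrier_mat a m"
    and a: "a = l * p + l * m"
  shows "data_vec p m l y u \<eta> (Suc (k + l)) =
    four_block_mat (aux_F p m l + aux_L p m l * Z1) (0\<^sub>m a b) (G * Z1) \<Phi> *\<^sub>v data_vec p m l y u \<eta> (k + l)
    + (aux_B p m l @\<^sub>r 0\<^sub>m b m) *\<^sub>v u (k + l)
    + ((aux_L p m l * Z2 * SS) @\<^sub>r (G * (Z2 * SS))) *\<^sub>v w (k + l)"
proof -
  define \<chi> where "\<chi> k = stack_vec l p (\<lambda>i. y (k + i)) @\<^sub>v stack_vec l m (\<lambda>i. u (k + i))" for k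
  have \<chi>: "\<chi> k \<in> carrier_vec a" for k unfolding \<chi>_def a by simp
  have yl: "y (k + l) \<in> carrier_vec p" and ul: "u (k + l) \<in> carrier_vec m"
    and wl: "w (k + l) \<in> carrier_vec nw"
    using le by (auto intro!: trajectory_facts)
  have ZS: "Z2 * SS \<in> carrier_mat p nw" using Z2 SS by auto
  have out: "y (k + l) = Z1 *\<^sub>v \<chi> k + (Z2 * SS) *\<^sub>v w (k + l)"
    using output_from_past[OF le OL] exo_stack_mult[of k l, OF _ det] le Z2(2) SS(2) wl
    unfolding Z1(1)[symmetric] Z2(1)[symmetric] SS(1)[symmetric] \<chi>_def[symmetric] by simp
  have "\<chi> (Suc k) = aux_F p m l *\<^sub>v \<chi> k + aux_L p m l *\<^sub>v y (k + l) + aux_B p m l *\<^sub>v u (k + l)"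
    unfolding \<chi>_def
    by (subst aux_state_step[of l "\<lambda>i. y (k + i)" p "\<lambda>i. u (k + i)" m]) (use le in \<open>auto intro!: trajectory_facts\<close>)
  also have "aux_L p m l *\<^sub>v y (k + l) =
      (aux_L p m l * Z1) *\<^sub>v \<chi> k + (aux_L p m l * Z2 * SS) *\<^sub>v w (k + l)"
  proof -
    have "aux_L p m l * Z2 * SS = aux_L p m l * (Z2 * SS)"
      by (rule assoc_mult_mat[OF L Z2(2) SS(2)])
    moreover have "Z1 *\<^sub>v \<chi> k \<in> carrier_vec p" "(Z2 * SS) *\<^sub>v w (k + l) \<in> carrier_vec p"
      using Z1(2) \<chi> ZS wl by (auto intro!: mult_mat_vec_carrier)
    ultimately show ?thesis unfolding out
      using L Z1(2) \<chi>[of k] ZS wl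
      by (simp add: mult_add_distrib_mat_vec[of _ a p] assoc_mult_mat_vec[of _ a p])
  qed
  also have "aux_F p m l *\<^sub>v \<chi> k + ((aux_L p m l * Z1) *\<^sub>v \<chi> k + (aux_L p m l * Z2 * SS) *\<^sub>v w (k + l))
      + aux_B p m l *\<^sub>v u (k + l)
    = (aux_F p m l + aux_L p m l * Z1) *\<^sub>v \<chi> k + aux_B p m l *\<^sub>v u (k + l)
      + (aux_L p m l * Z2 * SS) *\<^sub>v w (k + l)"
  proof -
    have "(aux_F p m l + aux_L p m l * Z1) *\<^sub>v \<chi> k = aux_F p m l *\<^sub>v \<chi> k + (aux_L p m l * Z1) *\<^sub>v \<chi> k"
      by (rule add_mult_distrib_mat_vec[OF F _ \<chi>]) (use L Z1 in auto)
    moreover have "e1 + (e2 + e3) + e4 = e1 + e2 + e4 + e3"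
      if "e1 \<in> carrier_vec a" "e2 \<in> carrier_vec a" "e3 \<in> carrier_vec a" "e4 \<in> carrier_vec a"
      for e1 e2 e3 e4 :: "real vec"
      using that by (intro eq_vecI) auto
    moreover have "aux_F p m l *\<^sub>v \<chi> k \<in> carrier_vec a" "(aux_L p m l * Z1) *\<^sub>v \<chi> k \<in> carrier_vec a"
       "(aux_L p m l * Z2 * SS) *\<^sub>v w (k + l) \<in> carrier_vec a" "aux_B p m l *\<^sub>v u (k + l) \<in> carrier_vec a"
      using F L B by (auto intro!: carrier_vecI)
    ultimately show ?thesis by metis
  qed
  finally have \<chi>_step: "\<chi> (Suc k) = \<dots>" .
  have d1: "data_vec p m l y u \<eta> (k + l) = \<chi> k @\<^sub>v \<eta> (k + l)"
    unfolding data_vec_def \<chi>_def by (simp add: append_vec_assoc)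
  have d2: "data_vec p m l y u \<eta> (Suc (k + l)) = \<chi> (Suc k) @\<^sub>v \<eta> (Suc (k + l))"
    unfolding data_vec_def \<chi>_def by (simp add: append_vec_assoc Suc_diff_le)
  show ?thesis
    unfolding d1 d2 \<chi>_step \<eta>(2) out
    by (rule stacked_step[OF _ B _ \<Phi> G Z1(2) ZS \<chi> \<eta>(1) ul wl]) (use F L Z1 Z2 SS in auto)
qed

end

section \<open>The internal model and the regulated output\<close>

text \<open>Component \<open>a\<close> of block \<open>i\<close> of the internal model: the copies of the companion matrix of \<open>q\<close> for
  different \<open>a\<close> do not interact.\<close>

lemma int_model_component:
  assumes \<mu>: "\<mu> \<in> carrier_vec (d * p)" and \<phi>: "\<phi> \<in> carrier_vec p" and d: "d = degree q"
    and i: "i < d" and a: "a < p"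
  shows "(int_model_Phi p q *\<^sub>v \<mu> + int_model_G p q *\<^sub>v \<phi>) $ (i * p + a) =
    (if Suc i < d then \<mu> $ (Suc i * p + a)
     else \<phi> $ a - (\<Sum>j<d. coeff q j * \<mu> $ (j * p + a)))"
proof -
  define f where "f j = vec p (\<lambda>a. \<mu> $ (j * p + a))" for j
  have f: "f j \<in> carrier_vec p" for j by (simp add: f_def)
  have \<mu>f: "\<mu> = stack_vec d p f"
    using \<mu> by (auto intro!: eq_vecI simp: f_def block_index)
  have idx: "i * p + a < d * p" using i a by (rule block_index_less)
  have dm: "(i * p + a) div p = i" "(i * p + a) mod p = a" using a by simp_all
  have "(int_model_Phi p q *\<^sub>v \<mu>) $ (i * p + a) = (\<Sum>j<d. ((if Suc i < d
      then (if j = Suc i then 1\<^sub>m p else 0\<^sub>m p p) else (- coeff q j) \<cdot>\<^sub>m 1\<^sub>m p) *\<^sub>v f j) $ a)"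
    unfolding int_model_Phi_def \<mu>f d[symmetric]
    by (subst block_mat_mult_stack_vec) (use idx f a in \<open>auto simp: dm cong: if_cong\<close>)
  also have "\<dots> = (if Suc i < d then \<mu> $ (Suc i * p + a) else - (\<Sum>j<d. coeff q j * \<mu> $ (j * p + a)))"
  proof (cases "Suc i < d")
    case True
    have "(\<Sum>j<d. ((if j = Suc i then 1\<^sub>m p else 0\<^sub>m p p) *\<^sub>v f j) $ a) =
        (\<Sum>j<d. if j = Suc i then f j $ a else 0)"
      using f a by (intro sum.cong) auto
    then show ?thesis using True a by (simp add: f_def)
  next
    case False
    have "(((- coeff q j) \<cdot>\<^sub>m 1\<^sub>m p) *\<^sub>v f j) $ a = - (coeff q j * \<mu> $ (j * p + a))" for j
    proof -
      have "((- coeff q j) \<cdot>\<^sub>m 1\<^sub>m p) *\<^sub>v f j = (- coeff q j) \<cdot>\<^sub>v (1\<^sub>m p *\<^sub>v f j)"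
        using f[of j] by (intro eq_vecI) (auto simp: smult_scalar_prod_distrib[of _ p])
      then show ?thesis using f[of j] a by (simp add: f_def)
    qed
    then show ?thesis using False by (simp add: sum_negf)
  qed
  finally have 1: "(int_model_Phi p q *\<^sub>v \<mu>) $ (i * p + a) = \<dots>" .
  have 2: "(int_model_G p q *\<^sub>v \<phi>) $ (i * p + a) = (if Suc i = d then \<phi> $ a else 0)"
    using block_mat_mult_stack_vec[of d 1 "\<lambda>i _. if Suc i = d then 1\<^sub>m p else 0\<^sub>m p p" p p "\<lambda>_. \<phi>" "i * p + a"]
      idx \<phi> a dm
    unfolding int_model_G_def d[symmetric] stack_vec_1[OF \<phi>] by auto
  have "(int_model_Phi p q *\<^sub>v \<mu> + int_model_G p q *\<^sub>v \<phi>) $ (i * p + a) =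
      (int_model_Phi p q *\<^sub>v \<mu>) $ (i * p + a) + (int_model_G p q *\<^sub>v \<phi>) $ (i * p + a)"
    using idx d by (simp add: int_model_G_def block_mat_def)
  with 1 2 i show ?thesis by auto
qed

text \<open>In companion form the block \<open>j\<close> of \<open>\<mu> k\<close> is the first block of \<open>\<mu> (k + j)\<close>, and the last block row
  states that \<open>q\<close>, read as a polynomial in the time shift, maps the first block to the input \<open>\<phi>\<close>.\<close>

lemma int_model_reconstructs_input:
  assumes \<mu>: "\<And>k. \<mu> k \<in> carrier_vec (d * p)" and \<phi>: "\<And>k. \<phi> k \<in> carrier_vec p"
    and step: "\<And>k. \<mu> (Suc k) = int_model_Phi p q *\<^sub>v \<mu> k + int_model_G p q *\<^sub>v \<phi> k"
    and q: "d = degree q" "lead_coeff q = 1" and d: "0 < d" and a: "a < p"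
  shows "\<phi> k $ a = (\<Sum>j\<le>d. coeff q j * \<mu> (k + j) $ a)"
proof -
  note comp = int_model_component[OF \<mu> \<phi> q(1) _ a]
  have shift: "\<mu> (k + j) $ a = \<mu> k $ (j * p + a)" if "j < d" for j k
    using that
  proof (induction j arbitrary: k)
    case (Suc j)
    have "\<mu> (k + Suc j) $ a = \<mu> (Suc k) $ (j * p + a)" using Suc.IH[of "Suc k"] Suc.prems by simp
    also have "\<dots> = \<mu> k $ (Suc j * p + a)" unfolding step using comp[of j k k] Suc.prems by simp
    finally show ?case .
  qed simp
  have "\<mu> (k + d) $ a = \<mu> (Suc k) $ ((d - 1) * p + a)"
    using shift[of "d - 1" "Suc k"] d by simp
  also have "\<dots> = \<phi> k $ a - (\<Sum>j<d. coeff q j * \<mu> k $ (j * p + a))"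
    unfolding step using comp[of "d - 1" k k] d by simp
  also have "(\<Sum>j<d. coeff q j * \<mu> k $ (j * p + a)) = (\<Sum>j<d. coeff q j * \<mu> (k + j) $ a)"
    using shift by (intro sum.cong) auto
  finally show ?thesis using q
    by (simp add: lessThan_Suc_atMost[symmetric] sum.lessThan_Suc)
qed

text \<open>Along a trajectory of \<open>S\<close> the time shift acts as \<open>S\<close>, so \<open>q\<close> of the shift acts as \<open>q(S)\<close>.\<close>

lemma annihilated_sequence:
  assumes S: "S \<in> carrier_mat nw nw" and q: "poly_mat q S = 0\<^sub>m nw nw"
    and \<omega>: "\<And>k. \<omega> k \<in> carrier_vec nw" "\<And>k. \<omega> (Suc k) = S *\<^sub>v \<omega> k" and t: "t < nw"
  shows "(\<Sum>j\<le>degree q. coeff q j * \<omega> (k + j) $ t) = 0"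
proof -
  have pow: "\<omega> (k + j) = S ^\<^sub>m j *\<^sub>v \<omega> k" for j
  proof (induction j)
    case 0
    then show ?case using S \<omega>(1)[of k] by simp
  next
    case (Suc j)
    have "\<omega> (k + Suc j) = S *\<^sub>v (S ^\<^sub>m j *\<^sub>v \<omega> k)" using \<omega>(2)[of "k + j"] Suc by simp
    also have "\<dots> = S ^\<^sub>m Suc j *\<^sub>v \<omega> k" unfolding pow_mat_Suc_left[OF S]
      using S \<omega>(1)[of k] by (simp add: assoc_mult_mat_vec[of _ nw nw _ nw])
    finally show ?case .
  qed
  have "(\<Sum>j\<le>degree q. coeff q j * \<omega> (k + j) $ t)
      = (\<Sum>j\<le>degree q. \<Sum>s<nw. coeff q j * (S ^\<^sub>m j) $$ (t, s) * \<omega> k $ s)"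
    unfolding pow using S \<omega>(1)[of k] t
    by (intro sum.cong) (auto simp: scalar_prod_def sum_distrib_left lessThan_atLeast0 ac_simps)
  also have "\<dots> = (\<Sum>s<nw. poly_mat q S $$ (t, s) * \<omega> k $ s)"
    using S t by (subst sum.swap) (auto simp: poly_mat_def sum_distrib_right intro!: sum.cong)
  also have "\<dots> = 0" unfolding q using t by simp
  finally show ?thesis .
qed

text \<open>A combination of time shifts with constant coefficients commutes with the dynamics. When it
  annihilates the exosignal, the filtered state follows the unforced stable system.\<close>

lemma filtered_state_tendsto_0:
  assumes A: "A \<in> carrier_mat N N" and D: "D \<in> carrier_mat N nw"
    and ev: "\<And>e. eigenvalue (map_mat complex_of_real A) e \<Longrightarrow> cmod e < 1"
    and z: "\<And>k. z k \<in> carrier_vec N" and \<omega>: "\<And>k. \<omega> k \<in> carrier_vec nw"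
    and step: "\<And>k. z (Suc k) = A *\<^sub>v z k + D *\<^sub>v \<omega> k"
    and ann: "\<And>k t. t < nw \<Longrightarrow> (\<Sum>j\<le>d. c j * \<omega> (k + j) $ t) = 0"
    and i: "i < N"
  shows "(\<lambda>k. \<Sum>j\<le>d. c j * z (k + j) $ i) \<longlonglongrightarrow> 0"
proof -
  define \<zeta> where "\<zeta> k = vec N (\<lambda>i. \<Sum>j\<le>d. c j * z (k + j) $ i)" for k
  have \<zeta>: "\<zeta> k \<in> carrier_vec N" for k by (simp add: \<zeta>_def)
  have rec: "\<zeta> (Suc k) = A *\<^sub>v \<zeta> k" for k
  proof (rule eq_vecI)
    fix i assume "i < dim_vec (A *\<^sub>v \<zeta> k)"
    then have i: "i < N" using A by simp
    have "\<zeta> (Suc k) $ i = (\<Sum>j\<le>d. c j * ((\<Sum>s<N. A $$ (i, s) * z (k + j) $ s)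
        + (\<Sum>t<nw. D $$ (i, t) * \<omega> (k + j) $ t)))"
    proof -
      have "z (Suc (k + j)) $ i = (\<Sum>s<N. A $$ (i, s) * z (k + j) $ s)
        + (\<Sum>t<nw. D $$ (i, t) * \<omega> (k + j) $ t)" for j
        unfolding step using i A D z[of "k + j"] \<omega>[of "k + j"]
        by (simp add: scalar_prod_def lessThan_atLeast0)
      then show ?thesis using i by (simp add: \<zeta>_def)
    qed
    also have "\<dots> = (\<Sum>j\<le>d. \<Sum>s<N. A $$ (i, s) * (c j * z (k + j) $ s))
        + (\<Sum>j\<le>d. \<Sum>t<nw. D $$ (i, t) * (c j * \<omega> (k + j) $ t))"
      by (simp add: distrib_left sum.distrib sum_distrib_left ac_simps)
    also have "(\<Sum>j\<le>d. \<Sum>s<N. A $$ (i, s) * (c j * z (k + j) $ s)) =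
        (\<Sum>s<N. A $$ (i, s) * (\<Sum>j\<le>d. c j * z (k + j) $ s))"
      by (subst sum.swap) (simp add: sum_distrib_left)
    also have "(\<Sum>j\<le>d. \<Sum>t<nw. D $$ (i, t) * (c j * \<omega> (k + j) $ t)) =
        (\<Sum>t<nw. D $$ (i, t) * (\<Sum>j\<le>d. c j * \<omega> (k + j) $ t))"
      by (subst sum.swap) (simp add: sum_distrib_left)
    also have "(\<Sum>t<nw. D $$ (i, t) * (\<Sum>j\<le>d. c j * \<omega> (k + j) $ t)) = 0"
      using ann by simp
    also have "(\<Sum>s<N. A $$ (i, s) * (\<Sum>j\<le>d. c j * z (k + j) $ s)) + 0 = (A *\<^sub>v \<zeta> k) $ i"
      using i A by (simp add: \<zeta>_def scalar_prod_def lessThan_atLeast0)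
    finally show "\<zeta> (Suc k) $ i = (A *\<^sub>v \<zeta> k) $ i" .
  qed (use A in \<open>simp add: \<zeta>_def\<close>)
  have "((*\<^sub>v) A ^^ k) (\<zeta> 0) = \<zeta> k" for k
    by (induction k) (simp_all add: rec)
  moreover have "origin_GAS N ((*\<^sub>v) A)" by (rule origin_GAS_linear[OF A ev]) auto
  ultimately have "(\<lambda>k. eucl_norm (\<zeta> k)) \<longlonglongrightarrow> 0"
    unfolding origin_GAS_def using \<zeta>[of 0] by fastforce
  then show ?thesis
    using eucl_norm_tendsto_0_iff[of \<zeta> N] i by (simp add: \<zeta>_def)
qed

section \<open>Output regulation\<close>

theorem theorem4p1:
  fixes S A B P C Q OL \<Phi> G U1 \<Psi>0 \<Psi>1 W0 Lhat Mhat Z1 Z2 SS AA BB LL X Y K :: "real mat"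
    and w x u y \<eta> \<psi> :: "nat \<Rightarrow> real vec"
    and q :: "real poly"
    and n m p nw nh l d N T :: nat
    and step :: "real vec \<times> real vec \<times> real vec \<Rightarrow> real vec \<times> real vec \<times> real vec"
  assumes plant_dims: "S \<in> carrier_mat nw nw" "A \<in> carrier_mat n n" "B \<in> carrier_mat n m"
      "P \<in> carrier_mat n nw" "C \<in> carrier_mat p n" "Q \<in> carrier_mat p nw"
    and eigenvalues: "\<And>z. eigenvalue (map_mat complex_of_real S) z \<Longrightarrow> 1 \<le> cmod z"
    and observability: "observable A C" "l = obs_index A C"
    and internal_model: "is_minimal_poly S q" "d = degree q"
      "\<Phi> = int_model_Phi p q" "G = int_model_G p q"
    and trajectory: "l \<le> T" "plant_trajectory T S A B P C Q w x u y"
      "int_model_trajectory T \<Phi> G y \<eta>"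
    and data: "\<psi> = data_vec p m l y u \<eta>" "N = (m + p) * l + p * d"
      "U1 = data_mat m u l T" "\<Psi>0 = data_mat N \<psi> l T" "\<Psi>1 = data_mat N \<psi> (l + 1) (T + 1)"
      "W0 = data_mat nw w l T"
    and exo_data: "Lhat \<in> carrier_mat nw nh" "Mhat \<in> carrier_mat nh (T - l + 1)"
      "W0 = Lhat * Mhat"
    and left_inverse: "OL \<in> carrier_mat n (p * l)" "OL * obs_mat A C l = 1\<^sub>m n"
    and auxiliary: "Z1 = aux_Z1 A B C OL l" "Z2 = aux_Z2 A P C Q OL l" "SS = exo_stack S l"
      "LL = aux_L p m l" "BB = aux_B p m l" "AA = aux_F p m l + LL * Z1"
    and feasible: "sdp_feasible N (T - l + 1) nh \<Psi>0 \<Psi>1 Mhat X Y"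
    and controller: "K = U1 * Y * inv_mat X"
    and closed_loop: "step = closed_loop_step S AA BB LL Z1 Z2 SS \<Phi> G K"
  shows "origin_GAS N (zero_exo_dynamics nw ((p + m) * l) (p * d) step) \<and>
    (\<forall>\<omega> \<in> carrier_vec nw. \<forall>\<xi> \<in> carrier_vec ((p + m) * l). \<forall>\<mu> \<in> carrier_vec (p * d).
       (\<lambda>k. eucl_norm (aux_output Z1 Z2 SS ((step ^^ k) (\<omega>, \<xi>, \<mu>)))) \<longlonglongrightarrow> 0)"
proof -
  define a where "a = l * p + l * m"
  define b where "b = d * p"
  have ab: "(p + m) * l = a" "p * d = b" "N = a + b"
    unfolding a_def b_def data(2) by (simp_all add: algebra_simps)
  interpret plant_data S A B P C Q w x u y n m p nw T
    using plant_dims trajectory by unfold_locales auto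
  have det: "det S \<noteq> 0"
    using det_nonzero_if_no_zero_eigenvalue[OF plant_dims(1)] eigenvalues by fastforce
  have OL: "OL \<in> carrier_mat n (l * p)" using left_inverse(1) by (simp add: mult.commute)
  note q = internal_model(1)[unfolded is_minimal_poly_def]
  have q1: "lead_coeff q = 1" and q0: "poly_mat q S = 0\<^sub>m nw nw" using q plant_dims(1) by auto
  note ac = aux_carriers[of l]
  have "C * A ^\<^sub>m l \<in> carrier_mat p n" using plant_dims(2,5) by simp
  then have CAO: "C * A ^\<^sub>m l * OL \<in> carrier_mat p (l * p)" using OL by (rule mult_carrier_mat)
  have Z1: "Z1 \<in> carrier_mat p a"
    unfolding auxiliary(1) aux_Z1_def a_def
    by (intro append_cols_carrier[OF CAO] minus_carrier_mat mult_carrier_mat[OF CAO ac(2)])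
  have Z2: "Z2 \<in> carrier_mat p (l * nw + nw)"
    unfolding auxiliary(2) aux_Z2_def
    by (intro append_cols_carrier[OF _ plant_dims(6)] minus_carrier_mat mult_carrier_mat[OF CAO ac(3)])
  have SS: "SS \<in> carrier_mat (l * nw + nw) nw"
    using block_mat_carrier[of "Suc l" 1 nw nw "\<lambda>i _. inv_mat S ^\<^sub>m (l - i)"] plant_dims(1)
    unfolding auxiliary(3) exo_stack_def by (simp add: add.commute)
  have ZS: "Z2 * SS \<in> carrier_mat p nw" using Z2 SS by auto
  have LL: "LL \<in> carrier_mat a p"
    unfolding auxiliary(4) aux_L_def a_def by (intro carrier_append_rows) (simp_all add: last_block_def block_mat_def)
  have BB: "BB \<in> carrier_mat a m"
    unfolding auxiliary(5) aux_B_def a_def by (intro carrier_append_rows) (simp_all add: last_block_def block_mat_def)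
  have FF: "aux_F p m l \<in> carrier_mat a a"
    unfolding aux_F_def a_def by (intro four_block_carrier_mat) (simp_all add: shift_mat_def)
  have AA: "AA \<in> carrier_mat a a" unfolding auxiliary(6) using FF LL Z1 by auto
  have \<Phi>: "\<Phi> \<in> carrier_mat b b" and G: "G \<in> carrier_mat b p"
    unfolding b_def internal_model(2-4) int_model_Phi_def int_model_G_def by (simp_all add: block_mat_def)
  define Lw where "Lw = LL * Z2 * SS"
  have Lw: "Lw \<in> carrier_mat a nw" unfolding Lw_def using LL Z2 SS by auto
  define A0 where "A0 = four_block_mat AA (0\<^sub>m a b) (G * Z1) \<Phi>"
  define B0 where "B0 = BB @\<^sub>r 0\<^sub>m b m"
  define D where "D = Lw @\<^sub>r (G * (Z2 * SS))"
  have A0: "A0 \<in> carrier_mat N N"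
    unfolding A0_def ab(3) by (rule four_block_carrier_mat[OF AA \<Phi>])
  have B0: "B0 \<in> carrier_mat N m" unfolding B0_def ab(3) using BB by (intro carrier_append_rows) auto
  have D: "D \<in> carrier_mat N nw" unfolding D_def ab(3) using Lw G ZS by (intro carrier_append_rows) auto
  have \<eta>: "k \<le> Suc T \<Longrightarrow> \<eta> k \<in> carrier_vec b"
    "k \<le> T \<Longrightarrow> \<eta> (Suc k) = \<Phi> *\<^sub>v \<eta> k + G *\<^sub>v y k" for k
  proof -
    show step: "k \<le> T \<Longrightarrow> \<eta> (Suc k) = \<Phi> *\<^sub>v \<eta> k + G *\<^sub>v y k" for k
      using trajectory(3) by (simp add: int_model_trajectory_def)
    show "k \<le> Suc T \<Longrightarrow> \<eta> k \<in> carrier_vec b"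
    proof (induction k)
      case 0
      then show ?case using trajectory(3) \<Phi> by (simp add: int_model_trajectory_def)
    next
      case (Suc k)
      then show ?case using step[of k] trajectory_facts(7)[of k] \<Phi> G by (auto intro!: add_carrier_vec mult_mat_vec_carrier)
    qed
  qed
  have \<psi>_step: "\<psi> (Suc k) = A0 *\<^sub>v \<psi> k + B0 *\<^sub>v u k + D *\<^sub>v w k" if "l \<le> k" "k \<le> T" for k
    using data_vec_step[of "k - l" l, OF _ det OL left_inverse(2) \<Phi> G _ _ auxiliary(1) Z1 auxiliary(2) Z2
        auxiliary(3) SS FF _ _ a_def] LL BB \<eta>[of k] that
    unfolding A0_def B0_def D_def Lw_def data(1) auxiliary(6) auxiliary(4,5)[symmetric] by simp
  have \<psi>: "\<psi> k \<in> carrier_vec N" if "k \<le> T" for k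
    unfolding data(1) data_vec_def ab(3) a_def add.assoc using \<eta>(1)[of k] that by auto
  have \<Psi>1: "\<Psi>1 = A0 * \<Psi>0 + B0 * U1 + D * (Lhat * Mhat)"
    unfolding exo_data(3)[symmetric] data(3-6)
    by (rule data_mat_recursion[of A0 N B0 m D nw l T \<psi> u w, OF A0 B0 D])
       (use \<psi> \<psi>_step trajectory_facts(4,5) in auto)
  have cols: "Suc T - l = T - l + 1" using trajectory(1) by simp
  have \<Psi>0: "\<Psi>0 \<in> carrier_mat N (T - l + 1)" and U1: "U1 \<in> carrier_mat m (T - l + 1)"
    unfolding data(3,4) cols[symmetric] by (rule data_mat_carrier)+
  have Xpd: "pos_def_mat N X" and Y: "Y \<in> carrier_mat (T - l + 1) N"
    and lmi: "pos_def_mat (2 * N) (four_block_mat X (\<Psi>1 * Y) (transpose_mat (\<Psi>1 * Y)) X)"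
    using feasible by (auto simp: sdp_feasible_def)
  have Xinv: "inv_mat X \<in> carrier_mat N N"
    using inv_mat_inverse(1)[OF pos_def_matD(1)[OF Xpd] pos_def_mat_det_nonzero[OF Xpd]] .
  have K: "K \<in> carrier_mat m N" unfolding controller using U1 Y Xinv by auto
  define Acl where "Acl = A0 + B0 * K"
  have Acl: "Acl \<in> carrier_mat N N" unfolding Acl_def using A0 B0 K by auto
  have "\<Psi>1 * Y = Acl * X"
    unfolding Acl_def controller
    by (rule sdp_feasible_closed_loop[OF feasible \<Psi>0 exo_data(2) U1 A0 B0 D exo_data(1) \<Psi>1])
  with lmi have "pos_def_mat (2 * N) (four_block_mat X (Acl * X) (transpose_mat (Acl * X)) X)" by simp
  then have ev: "cmod e < 1" if "eigenvalue (map_mat complex_of_real Acl) e" for e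
    using lmi_eigenvalue_norm_less_1[OF Xpd Acl _ that] by simp
  define nxt where "nxt \<omega> \<xi> \<mu> = AA *\<^sub>v \<xi> + BB *\<^sub>v (K *\<^sub>v (\<xi> @\<^sub>v \<mu>)) + Lw *\<^sub>v \<omega>" for \<omega> \<xi> \<mu>
  define out where "out \<omega> \<xi> = Z1 *\<^sub>v \<xi> + (Z2 * SS) *\<^sub>v \<omega>" for \<omega> \<xi>
  have step: "step (\<omega>, \<xi>, \<mu>) = (S *\<^sub>v \<omega>, nxt \<omega> \<xi> \<mu>, \<Phi> *\<^sub>v \<mu> + G *\<^sub>v out \<omega> \<xi>)" for \<omega> \<xi> \<mu>
    unfolding closed_loop closed_loop_step_def nxt_def out_def aux_output_def Lw_def by (simp add: Let_def)
  have carr: "nxt \<omega> \<xi> \<mu> \<in> carrier_vec a" "\<Phi> *\<^sub>v \<mu> + G *\<^sub>v out \<omega> \<xi> \<in> carrier_vec b"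
    "out \<omega> \<xi> \<in> carrier_vec p" for \<omega> \<xi> \<mu>
    unfolding nxt_def out_def using Lw G ZS by (auto intro!: carrier_vecI)
  have stacked: "nxt \<omega> \<xi> \<mu> @\<^sub>v (\<Phi> *\<^sub>v \<mu> + G *\<^sub>v out \<omega> \<xi>) = Acl *\<^sub>v (\<xi> @\<^sub>v \<mu>) + D *\<^sub>v \<omega>"
    if \<omega>: "\<omega> \<in> carrier_vec nw" and \<xi>: "\<xi> \<in> carrier_vec a" and \<mu>: "\<mu> \<in> carrier_vec b" for \<omega> \<xi> \<mu>
  proof -
    have z: "\<xi> @\<^sub>v \<mu> \<in> carrier_vec N" unfolding ab(3) using \<xi> \<mu> by simp
    have v: "K *\<^sub>v (\<xi> @\<^sub>v \<mu>) \<in> carrier_vec m" using K z by (rule mult_mat_vec_carrier)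
    have "Acl *\<^sub>v (\<xi> @\<^sub>v \<mu>) = A0 *\<^sub>v (\<xi> @\<^sub>v \<mu>) + (B0 * K) *\<^sub>v (\<xi> @\<^sub>v \<mu>)"
      unfolding Acl_def by (rule add_mult_distrib_mat_vec[OF A0 _ z]) (use B0 K in auto)
    also have "(B0 * K) *\<^sub>v (\<xi> @\<^sub>v \<mu>) = B0 *\<^sub>v (K *\<^sub>v (\<xi> @\<^sub>v \<mu>))"
      by (rule assoc_mult_mat_vec[OF B0 K z])
    finally have Az: "Acl *\<^sub>v (\<xi> @\<^sub>v \<mu>) = A0 *\<^sub>v (\<xi> @\<^sub>v \<mu>) + B0 *\<^sub>v (K *\<^sub>v (\<xi> @\<^sub>v \<mu>))" .
    show ?thesis unfolding Az unfolding nxt_def out_def A0_def B0_def D_def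
      by (rule stacked_step[OF AA BB Lw \<Phi> G Z1 ZS \<xi> \<mu> v \<omega>])
  qed
  have GAS: "origin_GAS N (zero_exo_dynamics nw a b step)"
  proof (rule origin_GAS_linear[OF Acl ev])
    fix z :: "real vec" assume z: "z \<in> carrier_vec N"
    have "zero_exo_dynamics nw a b step z =
        Acl *\<^sub>v (vec_first z a @\<^sub>v vec_last z b) + D *\<^sub>v 0\<^sub>v nw"
      unfolding zero_exo_dynamics_def step prod.case by (rule stacked) auto
    also have "D *\<^sub>v 0\<^sub>v nw = 0\<^sub>v N" using D by auto
    also have "vec_first z a @\<^sub>v vec_last z b = z" using z unfolding ab(3) by simp
    finally show "zero_exo_dynamics nw a b step z = Acl *\<^sub>v z" using Acl z by simp
  qed
  have "(\<lambda>k. eucl_norm (aux_output Z1 Z2 SS ((step ^^ k) (\<omega>, \<xi>, \<mu>)))) \<longlonglongrightarrow> 0"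
    if \<omega>0: "\<omega> \<in> carrier_vec nw" and \<xi>0: "\<xi> \<in> carrier_vec a" and \<mu>0: "\<mu> \<in> carrier_vec b" for \<omega> \<xi> \<mu>
  proof -
    define tr where "tr k = (step ^^ k) (\<omega>, \<xi>, \<mu>)" for k
    define Om where "Om k = fst (tr k)" for k
    define Xi where "Xi k = fst (snd (tr k))" for k
    define Mu where "Mu k = snd (snd (tr k))" for k
    define z where "z k = Xi k @\<^sub>v Mu k" for k
    define \<phi> where "\<phi> k = out (Om k) (Xi k)" for k
    have tr: "tr k = (Om k, Xi k, Mu k)" for k by (simp add: Om_def Xi_def Mu_def)
    have "tr (Suc k) = step (tr k)" for k by (simp add: tr_def)
    then have rec: "Om (Suc k) = S *\<^sub>v Om k" "Xi (Suc k) = nxt (Om k) (Xi k) (Mu k)"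
      "Mu (Suc k) = \<Phi> *\<^sub>v Mu k + G *\<^sub>v \<phi> k" for k
      using step[of "Om k" "Xi k" "Mu k"] tr[of k] tr[of "Suc k"] by (simp_all add: \<phi>_def)
    have init: "Om 0 = \<omega>" "Xi 0 = \<xi>" "Mu 0 = \<mu>" by (simp_all add: Om_def Xi_def Mu_def tr_def)
    have Om: "Om k \<in> carrier_vec nw" for k
      by (induction k) (use \<omega>0 plant_dims(1) in \<open>auto simp: init rec intro!: mult_mat_vec_carrier\<close>)
    have Xi: "Xi k \<in> carrier_vec a" for k
      by (cases k) (use \<xi>0 carr(1) in \<open>auto simp: init rec\<close>)
    have Mu: "Mu k \<in> carrier_vec b" for k
      by (cases k) (use \<mu>0 carr(2) in \<open>auto simp: init rec \<phi>_def\<close>)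
    have zc: "z k \<in> carrier_vec N" for k unfolding z_def ab(3) using Xi[of k] Mu[of k] by simp
    have z_step: "z (Suc k) = Acl *\<^sub>v z k + D *\<^sub>v Om k" for k
      unfolding z_def rec \<phi>_def by (rule stacked[OF Om Xi Mu])
    have \<phi>c: "\<phi> k \<in> carrier_vec p" for k unfolding \<phi>_def by (rule carr(3))
    have filtered: "(\<lambda>k. \<Sum>j\<le>d. coeff q j * z (k + j) $ i) \<longlonglongrightarrow> 0" if "i < N" for i
      by (rule filtered_state_tendsto_0[where z = z and \<omega> = Om, OF Acl D ev zc Om z_step _ that])
         (use annihilated_sequence[where \<omega> = Om, OF plant_dims(1) q0 Om rec(1)] internal_model(2) in auto)
    have "(\<lambda>k. \<phi> k $ i) \<longlonglongrightarrow> 0" if i: "i < p" for i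
    proof (cases "d = 0")
      case False
      have "i < b" using i False unfolding b_def by (cases d) auto
      then have z_Mu: "z k $ (a + i) = Mu k $ i" for k
        using Xi[of k] Mu[of k] unfolding z_def by simp
      have "\<phi> k $ i = (\<Sum>j\<le>d. coeff q j * Mu (k + j) $ i)" for k
        by (rule int_model_reconstructs_input[where \<mu> = Mu and \<phi> = \<phi> and p = p, OF _ \<phi>c _ internal_model(2) q1 _ i])
           (use Mu rec(3) False in \<open>auto simp: b_def internal_model\<close>)
      then show ?thesis using filtered[of "a + i"] \<open>i < b\<close> by (simp add: z_Mu ab(3))
    next
      case True
      \<comment> \<open>The minimal polynomial can only be constant if there is no exosignal. The internal model is then
        empty, and the filtered state is the state itself.\<close>
      have "nw = 0"
      proof (rule ccontr)
        assume "nw \<noteq> 0"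
        then have "poly_mat q S $$ (0, 0) = 1"
          using True internal_model(2) q1 plant_dims(1) by (simp add: poly_mat_def)
        then show False unfolding q0 using \<open>nw \<noteq> 0\<close> by simp
      qed
      have z0: "(\<lambda>k. z k $ t) \<longlonglongrightarrow> 0" if "t < N" for t
        using filtered[OF that] True q1 internal_model(2) by simp
      have "\<phi> k $ i = (\<Sum>t<a. Z1 $$ (i, t) * z k $ t)" for k
        unfolding \<phi>_def out_def z_def using i Z1 Z2 Xi[of k] Om[of k] Mu[of k] \<open>nw = 0\<close>
        by (simp add: scalar_prod_def lessThan_atLeast0)
      moreover have "(\<lambda>k. \<Sum>t<a. Z1 $$ (i, t) * z k $ t) \<longlonglongrightarrow> (\<Sum>t<a. Z1 $$ (i, t) * 0)"
        by (intro tendsto_intros z0) (simp add: ab(3))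
      ultimately show ?thesis by simp
    qed
    then have "(\<lambda>k. eucl_norm (\<phi> k)) \<longlonglongrightarrow> 0"
      using eucl_norm_tendsto_0_iff[of \<phi> p] \<phi>c by auto
    moreover have "aux_output Z1 Z2 SS ((step ^^ k) (\<omega>, \<xi>, \<mu>)) = \<phi> k" for k
      unfolding tr_def[symmetric] tr by (simp add: aux_output_def \<phi>_def out_def)
    ultimately show ?thesis by simp
  qed
  with GAS show ?thesis unfolding ab(1,2) by blast
qed

end
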